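(* Let $p$ be a prime and $q\in\mathbb{C}_p$ with $|1-q|_p<1$. For $n,k\in\mathbb{Z}_+$, $$\int_{\mathbb{Z}_p}\int_{\mathbb{Z}_p}B_{k,n}(x_1,x_2\mid q)\,d\mu_q(x_1)\,d\mu_q(x_2)=\begin{cases}\binom{n}{k}\beta_{k,q}\left(q^2\beta_{n-k,q^{-1}}+(n-k+1)-q\right), & \text{if } n>k+1,\\ 0, & \text{if } n<k,\\ \beta_{k,q}, & \text{if } n=k,\\ 1, & \text{if } n=k=0.\end{cases}$$
   Context: $\mathbb{Z}_p$ is the ring of $p$-adic integers and $\mathbb{C}_p$ the completion of the algebraic closure of $\mathbb{Q}_p$, with absolute value $|\cdot|_p$, $|p|_p=1/p$; $\mathbb{Z}_+=\{0,1,2,\dots\}$. For $x\in\mathbb{Z}_p$, $[x]_q=\frac{1-q^x}{1-q}$ and $[x]_{q^{-1}}=\frac{1-q^{-x}}{1-q^{-1}}$. For $x_1,x_2\in\mathbb{Z}_p$ and $n,k\in\mathbb{Z}_+$, $B_{k,n}(x_1,x_2\mid q)=\binom{n}{k}[x_1]_q^k[1-x_2]_{q^{-1}}^{n-k}$ if $n\ge k$ and $0$ if $n<k$. For a uniformly differentiable $f:\mathbb{Z}_p\to\mathbb{C}_p$, the bosonic $p$-adic $q$-integral is $\int_{\mathbb{Z}_p}f(x)\,d\mu_q(x)=\lim_{N\to\infty}\frac{1}{[p^N]_q}\sum_{x=0}^{p^N-1}f(x)q^x$. The Carlitz $q$-Bernoulli numbers $\beta_{k,q}$ are defined by $\beta_{0,q}=1$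 and $q(q\beta+1)^k-\beta_{k,q}=1$ if $k=1$, $=0$ if $k>1$, where after expanding $(q\beta+1)^k$ by the binomial theorem each power $\beta^i$ is replaced by $\beta_{i,q}$; $\beta_{k,q^{-1}}$ denotes the same numbers with $q$ replaced by $q^{-1}$.
   Formalization: Added: q is not a root of unity other than 1; for such q (e.g. q=-1, p=2) the denominators [p^N]_q vanish and the recurrence does not determine the Carlitz numbers, so the claim is undefined. At q=1, [x]_1 is read as x. *)

theory Defs
  imports
    "HOL-Analysis.Analysis"
    "HOL-Algebra.Algebraic_Closure_Type"
    "Berlekamp_Zassenhaus.Finite_Field"
begin

section \<open>Non-archimedean fields and their completions\<close>

class nonarch_field = field + metric_space +
  fixes absv :: "'a \<Rightarrow> real"
  assumes dist_absv: "dist x y = absv (x - y)"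
    and absv_mult: "absv (x * y) = absv x * absv y"
    and absv_add_le_max: "absv (x + y) \<le> max (absv x) (absv y)"
begin

lemma absv_eq_dist: "absv x = dist x 0"
  by (simp add: dist_absv)

lemma absv_nonneg [simp]: "absv x \<ge> 0"
  by (simp add: absv_eq_dist)

lemma absv_eq_0_iff [simp]: "absv x = 0 \<longleftrightarrow> x = 0"
  by (simp add: absv_eq_dist)

lemma absv_0 [simp]: "absv 0 = 0"
  by simp

lemma absv_pos_iff [simp]: "absv x > 0 \<longleftrightarrow> x \<noteq> 0"
  using absv_nonneg[of x] absv_eq_0_iff[of x] by linarith

lemma absv_1 [simp]: "absv 1 = 1"
  using absv_mult[of 1 1] absv_eq_0_iff[of 1] by simp

lemma absv_minus_commute: "absv (x - y) = absv (y - x)"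
  using dist_commute[of x y] by (simp add: dist_absv)

lemma absv_minus [simp]: "absv (- x) = absv x"
  using absv_minus_commute[of 0 x] by simp

lemma absv_diff_le_max: "absv (x - y) \<le> max (absv x) (absv y)"
  using absv_add_le_max[of x "- y"] by simp

lemma absv_add_le: "absv (x + y) \<le> absv x + absv y"
  using absv_add_le_max[of x y] absv_nonneg[of x] absv_nonneg[of y] by linarith

end

lemma absv_inverse: "absv (inverse x :: 'a::nonarch_field) = inverse (absv x)"
proof (cases "x = 0")
  case False
  then have "absv x * absv (inverse x) = 1"
    by (simp flip: absv_mult)
  then show ?thesis
    by (metis inverse_unique)
qed simp

lemma absv_divide: "absv (x / y) = absv x / absv y"
  by (simp add: divide_inverse absv_mult absv_inverse)

lemma absv_power: "absv (x ^ n) = absv x ^ n"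
  by (induction n) (simp_all add: absv_mult)

lemma abs_absv_diff_le: "\<bar>absv x - absv y\<bar> \<le> absv (x - y)"
  using absv_add_le[of "x - y" y] absv_add_le[of "y - x" x] absv_minus_commute[of x y]
  by simp

definition completion_rel :: "(nat \<Rightarrow> 'a::nonarch_field) \<Rightarrow> (nat \<Rightarrow> 'a) \<Rightarrow> bool" where
  "completion_rel S T \<longleftrightarrow> Cauchy S \<and> Cauchy T \<and> (\<lambda>n. dist (S n) (T n)) \<longlonglongrightarrow> 0"

lemma completion_rel_refl: "completion_rel S S \<longleftrightarrow> Cauchy S"
  by (simp add: completion_rel_def)

lemma Cauchy_const_seq: "Cauchy (\<lambda>n. c :: 'a::metric_space)"
  by (simp add: Cauchy_def)

quotient_type (overloaded) 'a completion = "nat \<Rightarrow> 'a::nonarch_field" / partial: completion_rel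
proof (rule part_equivpI)
  show "\<exists>S. completion_rel S S"
    using Cauchy_const_seq completion_rel_refl by blast
  show "symp completion_rel"
    by (auto simp: symp_def completion_rel_def dist_commute)
  show "transp completion_rel"
  proof (rule transpI)
    fix S T R assume ST: "completion_rel S T" and TR: "completion_rel T R"
    have lim: "(\<lambda>n. dist (S n) (T n) + dist (T n) (R n)) \<longlonglongrightarrow> 0"
      using tendsto_add[of "\<lambda>n. dist (S n) (T n)" 0 _ "\<lambda>n. dist (T n) (R n)" 0] ST TR
      by (simp add: completion_rel_def)
    have "(\<lambda>n. dist (S n) (R n)) \<longlonglongrightarrow> 0"
      by (rule Lim_null_comparison[OF _ lim]) (auto intro: always_eventually dist_triangle)
    with ST TR show "completion_rel S R"
      by (simp add: completion_rel_def)
  qed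
qed

lemma Cauchy_absv_bounded:
  fixes S :: "nat \<Rightarrow> 'a::nonarch_field"
  assumes "Cauchy S"
  obtains B where "B > 0" "\<And>n. absv (S n) \<le> B"
proof -
  obtain e where e: "\<forall>y\<in>range S. dist 0 y \<le> e"
    using cauchy_imp_bounded[OF assms] bounded_any_center[of "range S" 0] by auto
  show thesis
    by (rule that[of "max e 1"]) (use e in \<open>auto simp: absv_eq_dist dist_commute le_max_iff_disj\<close>)
qed

lemma Cauchy_add_nonarch:
  fixes S :: "nat \<Rightarrow> 'a::nonarch_field"
  assumes "Cauchy S" "Cauchy T"
  shows "Cauchy (\<lambda>n. S n + T n)"
proof (rule metric_CauchyI)
  fix e :: real assume "e > 0"
  obtain M where M: "\<And>m n. m \<ge> M \<Longrightarrow> n \<ge> M \<Longrightarrow> dist (S m) (S n) < e"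
    using metric_CauchyD[OF assms(1) \<open>e > 0\<close>] by blast
  obtain N where N: "\<And>m n. m \<ge> N \<Longrightarrow> n \<ge> N \<Longrightarrow> dist (T m) (T n) < e"
    using metric_CauchyD[OF assms(2) \<open>e > 0\<close>] by blast
  have "dist (S m + T m) (S n + T n) < e" if "m \<ge> max M N" "n \<ge> max M N" for m n
    using absv_add_le_max[of "S m - S n" "T m - T n"] M[of m n] N[of m n] that
    by (auto simp: dist_absv algebra_simps)
  then show "\<exists>M. \<forall>m\<ge>M. \<forall>n\<ge>M. dist (S m + T m) (S n + T n) < e"
    by blast
qed

lemma Cauchy_minus_nonarch:
  fixes S :: "nat \<Rightarrow> 'a::nonarch_field"
  assumes "Cauchy S"
  shows "Cauchy (\<lambda>n. - S n)"
proof -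
  have "dist (- S m) (- S n) = dist (S m) (S n)" for m n
    using absv_minus_commute[of "S m" "S n"] by (simp add: dist_absv)
  with assms show ?thesis
    by (simp add: Cauchy_def)
qed

lemma absv_mult_diff_le:
  fixes a b c d :: "'a::nonarch_field"
  assumes "absv a \<le> B" "absv d \<le> C"
  shows "absv (a * b - c * d) \<le> B * absv (b - d) + C * absv (a - c)"
proof -
  have "a * b - c * d = a * (b - d) + d * (a - c)"
    by (simp add: algebra_simps)
  then have "absv (a * b - c * d) \<le> absv a * absv (b - d) + absv d * absv (a - c)"
    using absv_add_le[of "a * (b - d)" "d * (a - c)"] by (simp add: absv_mult)
  also have "\<dots> \<le> B * absv (b - d) + C * absv (a - c)"
    using assms by (intro add_mono mult_right_mono) auto
  finally show ?thesis .
qed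

lemma Cauchy_mult_nonarch:
  fixes S :: "nat \<Rightarrow> 'a::nonarch_field"
  assumes "Cauchy S" "Cauchy T"
  shows "Cauchy (\<lambda>n. S n * T n)"
proof (rule metric_CauchyI)
  fix e :: real assume "e > 0"
  obtain B where B: "B > 0" "\<And>n. absv (S n) \<le> B"
    using Cauchy_absv_bounded[OF assms(1)] by blast
  obtain C where C: "C > 0" "\<And>n. absv (T n) \<le> C"
    using Cauchy_absv_bounded[OF assms(2)] by blast
  have "e / (2 * C) > 0" "e / (2 * B) > 0"
    using \<open>e > 0\<close> B C by auto
  obtain M where M: "\<And>m n. m \<ge> M \<Longrightarrow> n \<ge> M \<Longrightarrow> dist (S m) (S n) < e / (2 * C)"
    using metric_CauchyD[OF assms(1) \<open>e / (2 * C) > 0\<close>] by blast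
  obtain N where N: "\<And>m n. m \<ge> N \<Longrightarrow> n \<ge> N \<Longrightarrow> dist (T m) (T n) < e / (2 * B)"
    using metric_CauchyD[OF assms(2) \<open>e / (2 * B) > 0\<close>] by blast
  have "dist (S m * T m) (S n * T n) < e" if "m \<ge> max M N" "n \<ge> max M N" for m n
  proof -
    have "C * absv (S m - S n) < C * (e / (2 * C))"
      using M[of m n] that C by (intro mult_strict_left_mono) (auto simp: dist_absv)
    moreover have "B * absv (T m - T n) < B * (e / (2 * B))"
      using N[of m n] that B by (intro mult_strict_left_mono) (auto simp: dist_absv)
    ultimately show ?thesis
      using absv_mult_diff_le[OF B(2)[of m] C(2)[of n], of "T m" "S n"] B C
      by (simp add: dist_absv)
  qed
  then show "\<exists>M. \<forall>m\<ge>M. \<forall>n\<ge>M. dist (S m * T m) (S n * T n) < e"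
    by blast
qed

lemma completion_relI:
  assumes "Cauchy S" "Cauchy T" "f \<longlonglongrightarrow> 0" "\<And>n. dist (S n) (T n) \<le> f n"
  shows "completion_rel S T"
  unfolding completion_rel_def
  by (intro conjI assms(1,2), rule Lim_null_comparison[OF _ assms(3)])
     (auto intro: always_eventually assms(4))

definition null_seq :: "(nat \<Rightarrow> 'a::nonarch_field) \<Rightarrow> bool" where
  "null_seq S \<longleftrightarrow> (\<lambda>n. absv (S n)) \<longlonglongrightarrow> 0"

lemma completion_rel_null_iff:
  assumes "completion_rel S T"
  shows "null_seq S \<longleftrightarrow> null_seq T"
proof -
  have "(\<lambda>n. absv (S n) - absv (T n)) \<longlonglongrightarrow> 0"
    using assms unfolding completion_rel_def
    by - (rule Lim_null_comparison[where g = "\<lambda>n. dist (S n) (T n)"], auto intro: always_eventually simp: dist_absv abs_absv_diff_le)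
  then show ?thesis
    unfolding null_seq_def by (rule Lim_transform_eq)
qed

lemma Cauchy_not_null:
  fixes S :: "nat \<Rightarrow> 'a::nonarch_field"
  assumes "Cauchy S" "\<not> null_seq S"
  obtains r N where "r > 0" "\<And>n. n \<ge> N \<Longrightarrow> absv (S n) \<ge> r"
proof -
  obtain e where e: "e > 0" "\<And>N. \<exists>n\<ge>N. absv (S n) \<ge> e"
    using assms(2) unfolding null_seq_def LIMSEQ_iff by (auto simp: not_less)
  obtain N where N: "\<And>m n. m \<ge> N \<Longrightarrow> n \<ge> N \<Longrightarrow> dist (S m) (S n) < e / 2"
    using metric_CauchyD[OF assms(1), of "e / 2"] e by auto
  obtain m where m: "m \<ge> N" "absv (S m) \<ge> e"
    using e by blast
  show thesis
  proof (rule that[of "e / 2" N])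
    show "absv (S n) \<ge> e / 2" if "n \<ge> N" for n
      using N[of m n] m that abs_absv_diff_le[of "S m" "S n"] by (simp add: dist_absv)
  qed (use e in auto)
qed

lemma Cauchy_inverse_nonarch:
  fixes S :: "nat \<Rightarrow> 'a::nonarch_field"
  assumes "Cauchy S" "\<not> null_seq S"
  shows "Cauchy (\<lambda>n. inverse (S n))"
proof (rule metric_CauchyI)
  fix e :: real assume "e > 0"
  obtain r N where r: "r > 0" "\<And>n. n \<ge> N \<Longrightarrow> absv (S n) \<ge> r"
    using Cauchy_not_null[OF assms] by blast
  obtain M where M: "\<And>m n. m \<ge> M \<Longrightarrow> n \<ge> M \<Longrightarrow> dist (S m) (S n) < e * (r * r)"
    using metric_CauchyD[OF assms(1), of "e * (r * r)"] \<open>e > 0\<close> r by auto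
  have "dist (inverse (S m)) (inverse (S n)) < e" if "m \<ge> max M N" "n \<ge> max M N" for m n
  proof -
    have rm: "absv (S m) \<ge> r" and rn: "absv (S n) \<ge> r"
      using r that by auto
    have nz: "S m \<noteq> 0" "S n \<noteq> 0"
      using rm rn r(1) by auto
    have "inverse (S m) - inverse (S n) = (S n - S m) / (S m * S n)"
      using nz by (simp add: field_simps)
    then have "dist (inverse (S m)) (inverse (S n)) = absv (S m - S n) / (absv (S m) * absv (S n))"
      by (simp add: dist_absv absv_divide absv_mult absv_minus_commute)
    also have "\<dots> \<le> absv (S m - S n) / (r * r)"
      using rm rn r(1) nz by (intro divide_left_mono mult_mono) auto
    also have "\<dots> < e"
      using M[of m n] that r(1) by (simp add: dist_absv divide_less_eq)
    finally show ?thesis .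
  qed
  then show "\<exists>M. \<forall>m\<ge>M. \<forall>n\<ge>M. dist (inverse (S m)) (inverse (S n)) < e"
    by blast
qed

instantiation completion :: (nonarch_field) field
begin

lift_definition zero_completion :: "'a completion" is "\<lambda>n. 0"
  by (simp add: completion_rel_refl Cauchy_const_seq)

lift_definition one_completion :: "'a completion" is "\<lambda>n. 1"
  by (simp add: completion_rel_refl Cauchy_const_seq)

lift_definition plus_completion :: "'a completion \<Rightarrow> 'a completion \<Rightarrow> 'a completion"
  is "\<lambda>S T n. S n + T n"
proof -
  fix S S' T T' :: "nat \<Rightarrow> 'a"
  assume S: "completion_rel S S'" and T: "completion_rel T T'"
  have lim: "(\<lambda>n. dist (S n) (S' n) + dist (T n) (T' n)) \<longlonglongrightarrow> 0"
    using tendsto_add[of "\<lambda>n. dist (S n) (S' n)" 0 _ "\<lambda>n. dist (T n) (T' n)" 0] S T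
    by (simp add: completion_rel_def)
  show "completion_rel (\<lambda>n. S n + T n) (\<lambda>n. S' n + T' n)"
  proof (rule completion_relI[OF _ _ lim])
    show "dist (S n + T n) (S' n + T' n) \<le> dist (S n) (S' n) + dist (T n) (T' n)" for n
      using absv_add_le[of "S n - S' n" "T n - T' n"] by (simp add: dist_absv algebra_simps)
  qed (use S T in \<open>auto simp: completion_rel_def Cauchy_add_nonarch\<close>)
qed

lift_definition uminus_completion :: "'a completion \<Rightarrow> 'a completion" is "\<lambda>S n. - S n"
proof -
  fix S T :: "nat \<Rightarrow> 'a"
  assume "completion_rel S T"
  moreover have "dist (- S n) (- T n) = dist (S n) (T n)" for n
    using absv_minus_commute[of "S n" "T n"] by (simp add: dist_absv)
  ultimately show "completion_rel (\<lambda>n. - S n) (\<lambda>n. - T n)"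
    by (simp add: completion_rel_def Cauchy_minus_nonarch)
qed

definition minus_completion :: "'a completion \<Rightarrow> 'a completion \<Rightarrow> 'a completion" where
  "minus_completion x y = x + (- y)"

lift_definition times_completion :: "'a completion \<Rightarrow> 'a completion \<Rightarrow> 'a completion"
  is "\<lambda>S T n. S n * T n"
proof -
  fix S S' T T' :: "nat \<Rightarrow> 'a"
  assume S: "completion_rel S S'" and T: "completion_rel T T'"
  then have C: "Cauchy S" "Cauchy T'" "Cauchy S'" "Cauchy T"
    by (auto simp: completion_rel_def)
  obtain B where B: "B > 0" "\<And>n. absv (S n) \<le> B"
    using Cauchy_absv_bounded[OF C(1)] by blast
  obtain D where D: "D > 0" "\<And>n. absv (T' n) \<le> D"
    using Cauchy_absv_bounded[OF C(2)] by blast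
  have "(\<lambda>n. B * dist (T n) (T' n) + D * dist (S n) (S' n)) \<longlonglongrightarrow> B * 0 + D * 0"
    using S T unfolding completion_rel_def by (intro tendsto_intros) auto
  then have lim: "(\<lambda>n. B * dist (T n) (T' n) + D * dist (S n) (S' n)) \<longlonglongrightarrow> 0"
    by simp
  show "completion_rel (\<lambda>n. S n * T n) (\<lambda>n. S' n * T' n)"
  proof (rule completion_relI[OF _ _ lim])
    show "dist (S n * T n) (S' n * T' n) \<le> B * dist (T n) (T' n) + D * dist (S n) (S' n)" for n
      using absv_mult_diff_le[OF B(2) D(2), of n "T n" "S' n"] by (simp add: dist_absv)
  qed (use C in \<open>auto simp: Cauchy_mult_nonarch\<close>)
qed

lift_definition inverse_completion :: "'a completion \<Rightarrow> 'a completion"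
  is "\<lambda>S. if null_seq S then (\<lambda>n. 0) else (\<lambda>n. inverse (S n))"
proof -
  fix S T :: "nat \<Rightarrow> 'a"
  assume ST: "completion_rel S T"
  note null = completion_rel_null_iff[OF ST]
  show "completion_rel (if null_seq S then (\<lambda>n. 0) else (\<lambda>n. inverse (S n)))
          (if null_seq T then (\<lambda>n. 0) else (\<lambda>n. inverse (T n)))"
  proof (cases "null_seq S")
    case True
    with null show ?thesis by (simp add: completion_rel_refl Cauchy_const_seq)
  next
    case False
    have C: "Cauchy S" "Cauchy T" and lim: "(\<lambda>n. dist (S n) (T n)) \<longlonglongrightarrow> 0"
      using ST by (auto simp: completion_rel_def)
    obtain r N where r: "r > 0" "\<And>n. n \<ge> N \<Longrightarrow> absv (S n) \<ge> r"
      using Cauchy_not_null[OF C(1) False] by blast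
    obtain s M where s: "s > 0" "\<And>n. n \<ge> M \<Longrightarrow> absv (T n) \<ge> s"
      using Cauchy_not_null[OF C(2)] False null by blast
    have "(\<lambda>n. dist (S n) (T n) / (r * s)) \<longlonglongrightarrow> 0 / (r * s)"
      using lim r(1) s(1) by (intro tendsto_intros) auto
    then have lim': "(\<lambda>n. dist (S n) (T n) / (r * s)) \<longlonglongrightarrow> 0"
      by simp
    have "dist (inverse (S n)) (inverse (T n)) \<le> dist (S n) (T n) / (r * s)" if "n \<ge> max M N" for n
    proof -
      have rn: "absv (S n) \<ge> r" and sn: "absv (T n) \<ge> s"
        using r s that by auto
      have nz: "S n \<noteq> 0" "T n \<noteq> 0"
        using rn sn r(1) s(1) by auto
      have "inverse (S n) - inverse (T n) = (T n - S n) / (S n * T n)"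
        using nz by (simp add: field_simps)
      then have "dist (inverse (S n)) (inverse (T n)) = absv (S n - T n) / (absv (S n) * absv (T n))"
        by (simp add: dist_absv absv_divide absv_mult absv_minus_commute)
      also have "\<dots> \<le> absv (S n - T n) / (r * s)"
        using rn sn r(1) s(1) nz by (intro divide_left_mono mult_mono) auto
      finally show ?thesis
        by (simp add: dist_absv)
    qed
    then have "(\<lambda>n. dist (inverse (S n)) (inverse (T n))) \<longlonglongrightarrow> 0"
      by - (rule Lim_null_comparison[OF _ lim'],
         auto simp: eventually_sequentially intro!: exI[of _ "max M N"])
    with False null C show ?thesis
      by (simp add: completion_rel_def Cauchy_inverse_nonarch)
  qed
qed

definition divide_completion :: "'a completion \<Rightarrow> 'a completion \<Rightarrow> 'a completion" where
  "divide_completion x y = x * inverse y"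

lemma completion_rel_eqI: "Cauchy S \<Longrightarrow> (\<And>n. S n = T n) \<Longrightarrow> completion_rel S T"
  by (metis completion_rel_refl ext)

instance
proof
  fix a b c :: "'a completion"
  show "a * b * c = a * (b * c)"
    by transfer (rule completion_rel_eqI,
      auto simp: completion_rel_refl Cauchy_mult_nonarch mult.assoc)
  show "a * b = b * a"
    by transfer (rule completion_rel_eqI,
      auto simp: completion_rel_refl Cauchy_mult_nonarch mult.commute)
  show "1 * a = a"
    by transfer (rule completion_rel_eqI, auto simp: completion_rel_refl)
  show "a + b + c = a + (b + c)"
    by transfer (rule completion_rel_eqI,
      auto simp: completion_rel_refl Cauchy_add_nonarch add.assoc)
  show "a + b = b + a"
    by transfer (rule completion_rel_eqI,
      auto simp: completion_rel_refl Cauchy_add_nonarch add.commute)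
  show "0 + a = a"
    by transfer (rule completion_rel_eqI, auto simp: completion_rel_refl)
  show "- a + a = 0"
    by transfer (rule completion_rel_eqI,
      auto simp: completion_rel_refl Cauchy_const_seq)
  show "a - b = a + - b"
    by (rule minus_completion_def)
  show "(a + b) * c = a * c + b * c"
    by transfer (rule completion_rel_eqI,
      auto simp: completion_rel_refl Cauchy_mult_nonarch Cauchy_add_nonarch algebra_simps)
  show "(0 :: 'a completion) \<noteq> 1"
    by transfer (auto simp: completion_rel_def dist_absv LIMSEQ_const_iff)
  show "inverse (0 :: 'a completion) = 0"
    by transfer (simp add: null_seq_def completion_rel_refl Cauchy_const_seq)
  show "a div b = a * inverse b"
    by (rule divide_completion_def)
  show "inverse a * a = 1" if "a \<noteq> 0"
    using that
  proof transfer
    fix S :: "nat \<Rightarrow> 'a"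
    assume "completion_rel S S" and n0: "\<not> completion_rel S (\<lambda>n. 0)"
    then have C: "Cauchy S"
      by (simp add: completion_rel_refl)
    have nn: "\<not> null_seq S"
      using n0 C by (simp add: completion_rel_def null_seq_def Cauchy_const_seq dist_absv)
    obtain r N where r: "r > 0" "\<And>n. n \<ge> N \<Longrightarrow> absv (S n) \<ge> r"
      using Cauchy_not_null[OF C nn] by blast
    have "S n \<noteq> 0" if "n \<ge> N" for n
      using r(1) r(2)[OF that] by auto
    then have "\<forall>\<^sub>F n in sequentially. dist (inverse (S n) * S n) 1 = 0"
      unfolding eventually_sequentially by (intro exI[of _ N]) auto
    then have "(\<lambda>n. dist (inverse (S n) * S n) 1) \<longlonglongrightarrow> 0"
      by (rule tendsto_eventually)
    with C nn show "completion_rel (\<lambda>n. (if null_seq S then \<lambda>n. 0 else (\<lambda>n. inverse (S n))) n * S n) (\<lambda>n. 1)"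
      by (simp add: completion_rel_def Cauchy_mult_nonarch Cauchy_inverse_nonarch Cauchy_const_seq)
  qed
qed

end

lemma Cauchy_absv_convergent:
  fixes S :: "nat \<Rightarrow> 'a::nonarch_field"
  assumes "Cauchy S"
  shows "convergent (\<lambda>n. absv (S n))"
proof -
  have "Cauchy (\<lambda>n. absv (S n))"
  proof (rule metric_CauchyI)
    fix e :: real assume "e > 0"
    then obtain M where M: "\<And>m n. m \<ge> M \<Longrightarrow> n \<ge> M \<Longrightarrow> dist (S m) (S n) < e"
      using metric_CauchyD[OF assms] by blast
    have "dist (absv (S m)) (absv (S n)) < e" if "m \<ge> M" "n \<ge> M" for m n
      using M[OF that] abs_absv_diff_le[of "S m" "S n"] by (simp add: dist_real_def dist_absv)
    then show "\<exists>M. \<forall>m\<ge>M. \<forall>n\<ge>M. dist (absv (S m)) (absv (S n)) < e"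
      by blast
  qed
  then show ?thesis
    by (rule real_Cauchy_convergent)
qed

instantiation completion :: (nonarch_field) nonarch_field
begin

lift_definition absv_completion :: "'a completion \<Rightarrow> real" is "\<lambda>S. lim (\<lambda>n. absv (S n))"
proof -
  fix S T :: "nat \<Rightarrow> 'a"
  assume ST: "completion_rel S T"
  have "(\<lambda>n. absv (S n) - absv (T n)) \<longlonglongrightarrow> 0"
    using ST unfolding completion_rel_def
    by - (rule Lim_null_comparison[where g = "\<lambda>n. dist (S n) (T n)"], auto intro: always_eventually simp: dist_absv abs_absv_diff_le)
  moreover have "(\<lambda>n. absv (S n)) \<longlonglongrightarrow> lim (\<lambda>n. absv (S n))"
      and "(\<lambda>n. absv (T n)) \<longlonglongrightarrow> lim (\<lambda>n. absv (T n))"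
    using ST Cauchy_absv_convergent unfolding completion_rel_def convergent_LIMSEQ_iff by auto
  ultimately show "lim (\<lambda>n. absv (S n)) = lim (\<lambda>n. absv (T n))"
    by (metis LIMSEQ_unique Lim_transform_eq)
qed

definition dist_completion :: "'a completion \<Rightarrow> 'a completion \<Rightarrow> real" where
  "dist_completion x y = absv (x - y)"

definition uniformity_completion :: "('a completion \<times> 'a completion) filter" where
  "uniformity_completion = (INF e\<in>{0<..}. principal {(x, y). dist x y < e})"

definition open_completion :: "'a completion set \<Rightarrow> bool" where
  "open_completion U \<longleftrightarrow> (\<forall>x\<in>U. \<forall>\<^sub>F (x', y) in uniformity. x' = x \<longrightarrow> y \<in> U)"

lemma absv_completion_lim:
  "Cauchy S \<Longrightarrow> (\<lambda>n. absv (S n :: 'a)) \<longlonglongrightarrow> lim (\<lambda>n. absv (S n))"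
  using Cauchy_absv_convergent convergent_LIMSEQ_iff by blast

instance
proof
  have mult: "absv (x * y) = absv x * absv y" for x y :: "'a completion"
  proof transfer
    fix S T :: "nat \<Rightarrow> 'a"
    assume "completion_rel S S" "completion_rel T T"
    then have "(\<lambda>n. absv (S n) * absv (T n)) \<longlonglongrightarrow> lim (\<lambda>n. absv (S n)) * lim (\<lambda>n. absv (T n))"
      by (intro tendsto_mult absv_completion_lim) (simp_all add: completion_rel_refl)
    then show "lim (\<lambda>n. absv (S n * T n)) = lim (\<lambda>n. absv (S n)) * lim (\<lambda>n. absv (T n))"
      by (simp add: absv_mult limI)
  qed
  have ultra: "absv (x + y) \<le> max (absv x) (absv y)" for x y :: "'a completion"
  proof transfer
    fix S T :: "nat \<Rightarrow> 'a"
    assume "completion_rel S S" "completion_rel T T"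
    then have C: "Cauchy S" "Cauchy T"
      by (simp_all add: completion_rel_refl)
    show "lim (\<lambda>n. absv (S n + T n)) \<le> max (lim (\<lambda>n. absv (S n))) (lim (\<lambda>n. absv (T n)))"
      by (rule LIMSEQ_le[OF absv_completion_lim tendsto_max[OF absv_completion_lim absv_completion_lim]])
         (use C in \<open>auto simp: Cauchy_add_nonarch absv_add_le_max\<close>)
  qed
  have zero: "absv x = 0 \<longleftrightarrow> x = 0" for x :: "'a completion"
  proof transfer
    fix S :: "nat \<Rightarrow> 'a"
    assume "completion_rel S S"
    then have C: "Cauchy S"
      by (simp add: completion_rel_refl)
    have "completion_rel S (\<lambda>n. 0) \<longleftrightarrow> (\<lambda>n. absv (S n)) \<longlonglongrightarrow> 0"
      using C by (simp add: completion_rel_def Cauchy_const_seq dist_absv)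
    also have "\<dots> \<longleftrightarrow> lim (\<lambda>n. absv (S n)) = 0"
      using absv_completion_lim[OF C] limI by metis
    finally show "lim (\<lambda>n. absv (S n)) = 0 \<longleftrightarrow> completion_rel S (\<lambda>n. 0)" ..
  qed
  have nonneg: "absv x \<ge> 0" for x :: "'a completion"
  proof transfer
    fix S :: "nat \<Rightarrow> 'a"
    assume "completion_rel S S"
    then show "lim (\<lambda>n. absv (S n)) \<ge> 0"
      by (intro LIMSEQ_le_const[OF absv_completion_lim]) (auto simp: completion_rel_refl)
  qed
  have "absv (- x) = absv x" for x :: "'a completion"
    by transfer simp
  then have sym: "absv (x - y) = absv (y - x)" for x y :: "'a completion"
    by (metis minus_diff_eq)
  fix x y z :: "'a completion"
  show "dist x y = absv (x - y)"
    by (rule dist_completion_def)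
  show "absv (x * y) = absv x * absv y"
    by (rule mult)
  show "absv (x + y) \<le> max (absv x) (absv y)"
    by (rule ultra)
  show "dist x y = 0 \<longleftrightarrow> x = y"
    by (simp add: dist_completion_def zero)
  show "dist x y \<le> dist x z + dist y z"
    using ultra[of "x - z" "z - y"] nonneg[of "x - z"] nonneg[of "y - z"] sym[of y z]
    by (simp add: dist_completion_def)
  show "uniformity = (INF e\<in>{0<..}. principal {(x :: 'a completion, y). dist x y < e})"
    by (rule uniformity_completion_def)
  show "open U \<longleftrightarrow> (\<forall>x\<in>U. \<forall>\<^sub>F (x', y) in uniformity. x' = x \<longrightarrow> y \<in> U)" for U :: "'a completion set"
    by (rule open_completion_def)
qed

end

lift_definition to_completion :: "'a::nonarch_field \<Rightarrow> 'a completion" is "\<lambda>x n. x"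
  by (simp add: completion_rel_refl Cauchy_const_seq)

lemma to_completion_0 [simp]: "to_completion 0 = 0"
  by (simp add: to_completion.abs_eq zero_completion_def)

lemma to_completion_1 [simp]: "to_completion 1 = 1"
  by (simp add: to_completion.abs_eq one_completion_def)

lemma to_completion_add [simp]: "to_completion (x + y) = to_completion x + to_completion y"
  by transfer (simp add: completion_rel_refl Cauchy_const_seq)

lemma to_completion_minus [simp]: "to_completion (- x) = - to_completion x"
  by transfer (simp add: completion_rel_refl Cauchy_const_seq)

lemma to_completion_diff [simp]: "to_completion (x - y) = to_completion x - to_completion y"
  using to_completion_add[of x "- y"] by simp

lemma to_completion_mult [simp]: "to_completion (x * y) = to_completion x * to_completion y"
  by transfer (simp add: completion_rel_refl Cauchy_const_seq)

lemma to_completion_of_nat [simp]: "to_completion (of_nat n) = of_nat n"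
  by (induction n) simp_all

lemma absv_to_completion [simp]: "absv (to_completion x) = absv x"
  by transfer simp

lemma to_completion_seq_tendsto:
  assumes "Cauchy S"
  shows "(\<lambda>n. to_completion (S n)) \<longlonglongrightarrow> abs_completion S"
proof (rule metric_LIMSEQ_I)
  fix e :: real assume e: "e > 0"
  obtain M where M: "\<And>m n. m \<ge> M \<Longrightarrow> n \<ge> M \<Longrightarrow> dist (S m) (S n) < e / 2"
    using metric_CauchyD[OF assms, of "e / 2"] e by auto
  have "dist (to_completion (S m)) (abs_completion S) < e" if m: "m \<ge> M" for m
  proof -
    have rX: "completion_rel S S" and rc: "completion_rel (\<lambda>n. c) (\<lambda>n. c)" for c :: 'a
      using assms by (simp_all add: completion_rel_refl Cauchy_const_seq)
    have C: "Cauchy (\<lambda>n. S m + - S n)"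
      by (intro Cauchy_add_nonarch Cauchy_minus_nonarch Cauchy_const_seq assms)
    have rm: "completion_rel (\<lambda>n. - S n) (\<lambda>n. - S n)"
      using Cauchy_minus_nonarch[OF assms] by (simp add: completion_rel_refl)
    have "dist (to_completion (S m)) (abs_completion S) = lim (\<lambda>n. absv (S m + - S n))"
      using C rX rc rm
      by (simp add: dist_absv minus_completion_def uminus_completion.abs_eq to_completion.abs_eq
          plus_completion.abs_eq absv_completion.abs_eq eq_onp_def completion_rel_refl)
    also have "\<dots> \<le> e / 2"
    proof (rule LIMSEQ_le_const2[OF absv_completion_lim[OF C]])
      show "\<exists>N. \<forall>n\<ge>N. absv (S m + - S n) \<le> e / 2"
        using M[OF m] by (intro exI[of _ M]) (auto simp: dist_absv less_imp_le)
    qed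
    finally show ?thesis
      using e by simp
  qed
  then show "\<exists>N. \<forall>n\<ge>N. dist (to_completion (S n)) (abs_completion S) < e"
    by blast
qed

lemma to_completion_dense: "closure (range (to_completion :: 'a::nonarch_field \<Rightarrow> _)) = UNIV"
proof -
  have "x \<in> closure (range to_completion)" for x :: "'a completion"
  proof -
    obtain S where "completion_rel S S" "x = abs_completion S"
      by (metis Quotient_completion Quotient_rep_reflp Quotient_abs_rep)
    then show ?thesis
      using to_completion_seq_tendsto[of S] 
      by (auto simp: closure_sequential completion_rel_refl intro!: exI[of _ "\<lambda>n. to_completion (S n)"])
  qed
  then show ?thesis by auto
qed

instance completion :: (nonarch_field) complete_space
proof
  fix S :: "nat \<Rightarrow> 'a completion"
  assume S: "Cauchy S"
  have "\<exists>y. dist (S n) (to_completion y) < inverse (real (Suc n))" for n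
  proof -
    have "S n \<in> closure (range to_completion)"
      by (simp add: to_completion_dense)
    then show ?thesis
      unfolding closure_approachable by (metis (no_types, lifting) dist_commute imageE
        inverse_positive_iff_positive of_nat_0_less_iff zero_less_Suc)
  qed
  then obtain T where T: "\<And>n. dist (S n) (to_completion (T n)) < inverse (real (Suc n))"
    by metis
  have null: "(\<lambda>n. dist (S n) (to_completion (T n))) \<longlonglongrightarrow> 0"
    by (rule Lim_null_comparison[OF _ LIMSEQ_inverse_real_of_nat])
       (auto intro!: always_eventually less_imp_le T simp del: of_nat_Suc)
  have CT: "Cauchy T"
  proof (rule metric_CauchyI)
    fix e :: real assume "e > 0"
    then have e: "e / 3 > 0" by simp
    obtain M where M: "\<And>m n. m \<ge> M \<Longrightarrow> n \<ge> M \<Longrightarrow> dist (S m) (S n) < e / 3"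
      using metric_CauchyD[OF S e] by blast
    obtain N where N: "\<And>n. n \<ge> N \<Longrightarrow> dist (S n) (to_completion (T n)) < e / 3"
      using metric_LIMSEQ_D[OF null e] by auto
    have "dist (T m) (T n) < e" if "m \<ge> max M N" "n \<ge> max M N" for m n
    proof -
      have "dist (T m) (T n) = dist (to_completion (T m)) (to_completion (T n))"
        by (simp add: dist_absv flip: to_completion_diff)
      also have "\<dots> \<le> dist (S m) (to_completion (T m)) + dist (S m) (S n) + dist (S n) (to_completion (T n))"
        using dist_triangle[of "to_completion (T m)" "to_completion (T n)" "S m"]
          dist_triangle[of "S m" "to_completion (T n)" "S n"]
          dist_commute[of "S m" "to_completion (T m)"] by linarith
      also have "\<dots> < e"
        using M[of m n] N[of m] N[of n] that by simp
      finally show ?thesis .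
    qed
    then show "\<exists>M. \<forall>m\<ge>M. \<forall>n\<ge>M. dist (T m) (T n) < e"
      by blast
  qed
  have "S \<longlonglongrightarrow> abs_completion T"
  proof -
    have lim: "(\<lambda>n. dist (S n) (to_completion (T n)) + dist (to_completion (T n)) (abs_completion T)) \<longlonglongrightarrow> 0"
      using tendsto_add[OF null iffD1[OF tendsto_dist_iff to_completion_seq_tendsto[OF CT]]] by simp
    have "(\<lambda>n. dist (S n) (abs_completion T)) \<longlonglongrightarrow> 0"
      by (rule Lim_null_comparison[OF _ lim]) (auto intro!: always_eventually dist_triangle)
    then show ?thesis
      by (subst tendsto_dist_iff)
  qed
  then show "convergent S"
    by (auto simp: convergent_def)
qed

section \<open>Extending the absolute value to the algebraic closure\<close>

text \<open>
  A subring that is maximal among those meeting the base field in its valuation ring is a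
  valuation ring, and its value group is torsion over that of the base field; this is where the
  existence of an extension of the absolute value comes from.
\<close>

definition ext_subring :: "'a::nonarch_field alg_closure set \<Rightarrow> bool" where
  "ext_subring A \<longleftrightarrow> (\<forall>c. to_ac c \<in> A \<longleftrightarrow> absv c \<le> 1) \<and>
     (\<forall>x\<in>A. \<forall>y\<in>A. x - y \<in> A \<and> x * y \<in> A)"

locale max_ext_subring =
  fixes V :: "'a::nonarch_field alg_closure set"
  assumes subring: "ext_subring V"
    and maximal: "\<And>A. ext_subring A \<Longrightarrow> V \<subseteq> A \<Longrightarrow> A = V"
begin

lemma to_ac_V_iff: "to_ac c \<in> V \<longleftrightarrow> absv c \<le> 1"
  using subring by (auto simp: ext_subring_def)

lemma V_diff: "x \<in> V \<Longrightarrow> y \<in> V \<Longrightarrow> x - y \<in> V"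
  and V_mult: "x \<in> V \<Longrightarrow> y \<in> V \<Longrightarrow> x * y \<in> V"
  using subring by (auto simp: ext_subring_def)

lemma V_1: "1 \<in> V"
  using to_ac_V_iff[of 1] by simp

lemma V_0: "0 \<in> V"
  using to_ac_V_iff[of 0] by simp

lemma V_add: "x \<in> V \<Longrightarrow> y \<in> V \<Longrightarrow> x + y \<in> V"
  using V_diff[of 0 y] V_diff[of x "- y"] V_0 by simp

lemma V_power: "x \<in> V \<Longrightarrow> x ^ n \<in> V"
  by (induction n) (auto intro: V_1 V_mult)

lemma V_sum: "(\<And>i. i \<in> S \<Longrightarrow> f i \<in> V) \<Longrightarrow> sum f S \<in> V"
  by (induction S rule: infinite_finite_induct) (auto intro: V_0 V_add)

definition I :: "'a alg_closure set" where
  "I = {to_ac c * v | c v. absv c < 1 \<and> v \<in> V}"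

lemma I_0: "0 \<in> I"
  unfolding I_def using V_0 by (intro CollectI exI[of _ 0]) simp

lemma I_mult: "a \<in> I \<Longrightarrow> v \<in> V \<Longrightarrow> a * v \<in> I"
  unfolding I_def using V_mult by (fastforce simp: mult.assoc)

lemma I_sub_V: "I \<subseteq> V"
  unfolding I_def using V_mult to_ac_V_iff by (auto simp: less_imp_le)

lemma I_add_aux:
  assumes "v \<in> V" "w \<in> V" "absv c < 1" "absv d \<le> absv c"
  shows "to_ac c * v + to_ac d * w \<in> I"
proof (cases "c = 0")
  case True
  then have "d = 0"
    using assms absv_nonneg[of d] absv_eq_0_iff[of d] by simp
  with True show ?thesis
    by (simp add: I_0)
next
  case False
  have "to_ac (d / c) \<in> V"
    unfolding to_ac_V_iff using assms False by (simp add: absv_divide divide_le_eq_1)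
  then have "v + to_ac (d / c) * w \<in> V"
    using assms V_add V_mult by blast
  moreover have "to_ac c * v + to_ac d * w = to_ac c * (v + to_ac (d / c) * w)"
    using False by (simp add: distrib_left)
  ultimately show ?thesis
    unfolding I_def using assms by blast
qed

lemma I_add: "a \<in> I \<Longrightarrow> b \<in> I \<Longrightarrow> a + b \<in> I"
proof -
  assume "a \<in> I" "b \<in> I"
  then obtain c v d w where
    *: "a = to_ac c * v" "absv c < 1" "v \<in> V" "b = to_ac d * w" "absv d < 1" "w \<in> V"
    unfolding I_def by auto
  show "a + b \<in> I"
    using I_add_aux[of v w c d] I_add_aux[of w v d c] * linear[of "absv c" "absv d"]
    by (auto simp: add.commute)
qed

lemma I_minus: "a \<in> I \<Longrightarrow> - a \<in> I"
  using I_mult[of a "- 1"] V_diff[OF V_0 V_1] by simp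

lemma I_diff: "a \<in> I \<Longrightarrow> b \<in> I \<Longrightarrow> a - b \<in> I"
  using I_add[of a "- b"] I_minus[of b] by simp

lemma I_scale: "absv c < 1 \<Longrightarrow> v \<in> V \<Longrightarrow> to_ac c * v \<in> I"
  unfolding I_def by blast

lemma one_notin_I: "1 \<notin> I"
proof
  assume "1 \<in> I"
  then obtain c v where c: "1 = to_ac c * v" "absv c < 1" "v \<in> V"
    unfolding I_def by auto
  then have "c \<noteq> 0"
    by auto
  with c have "v = to_ac (inverse c)"
    by (simp add: field_simps)
  with c have "inverse (absv c) \<le> 1"
    using to_ac_V_iff[of "inverse c"] by (simp add: absv_inverse)
  with c(2) \<open>c \<noteq> 0\<close> show False
    by (simp add: field_simps)
qed

lemma one_minus_I_unit:
  assumes a: "a \<in> I"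
  shows "1 - a \<noteq> 0" "inverse (1 - a) \<in> V"
proof -
  let ?u = "1 - a"
  show u0: "?u \<noteq> 0"
    using a one_notin_I by auto
  have uV: "?u \<in> V"
    using a I_sub_V V_1 V_diff by blast
  have uk: "1 - ?u ^ k \<in> I" for k
  proof (induction k)
    case (Suc k)
    have "1 - ?u ^ Suc k = (1 - ?u ^ k) + a * ?u ^ k"
      by (simp add: algebra_simps)
    moreover have "(1 - ?u ^ k) + a * ?u ^ k \<in> I"
      using Suc a uV I_add I_mult V_power by blast
    ultimately show ?case
      by metis
  qed (simp add: I_0)
  define A where "A = {v / ?u ^ k | v k. v \<in> V}"
  have "to_ac c \<in> A \<longleftrightarrow> absv c \<le> 1" for c
  proof
    assume "absv c \<le> 1"
    then show "to_ac c \<in> A"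
      unfolding A_def using to_ac_V_iff[of c] by (intro CollectI exI[of _ "to_ac c"] exI[of _ 0]) simp
  next
    assume "to_ac c \<in> A"
    then obtain v k where vk: "to_ac c = v / ?u ^ k" "v \<in> V"
      unfolding A_def by auto
    show "absv c \<le> 1"
    proof (rule ccontr)
      assume "\<not> absv c \<le> 1"
      then have c: "absv c > 1" "c \<noteq> 0"
        by auto
      have "?u ^ k = to_ac (inverse c) * v"
        using vk u0 c by (simp add: field_simps)
      moreover have "absv (inverse c) < 1"
        using c by (simp add: absv_inverse inverse_less_1_iff)
      ultimately have "?u ^ k \<in> I"
        using I_scale[of "inverse c" v] vk(2) by metis
      then have "1 \<in> I"
        using I_add[OF uk[of k], of "?u ^ k"] by simp
      then show False
        using one_notin_I by blast
    qed
  qed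
  moreover have "x - y \<in> A \<and> x * y \<in> A" if xy: "x \<in> A" "y \<in> A" for x y
  proof -
    obtain v k w l where *: "x = v / ?u ^ k" "y = w / ?u ^ l" "v \<in> V" "w \<in> V"
      using xy unfolding A_def by auto
    have "x - y = (v * ?u ^ l - w * ?u ^ k) / ?u ^ (k + l)"
      using u0 by (simp add: *(1,2) diff_frac_eq power_add)
    moreover have "x * y = (v * w) / ?u ^ (k + l)"
      by (simp add: *(1,2) power_add)
    moreover have "v * ?u ^ l - w * ?u ^ k \<in> V" "v * w \<in> V"
      using * uV by (auto intro!: V_diff V_mult V_power)
    ultimately show ?thesis
      unfolding A_def by blast
  qed
  ultimately have "ext_subring A"
    by (simp add: ext_subring_def)
  moreover have "V \<subseteq> A"
  proof
    fix v assume "v \<in> V"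
    then show "v \<in> A"
      unfolding A_def by (intro CollectI exI[of _ v] exI[of _ 0]) simp
  qed
  ultimately have "A = V"
    by (rule maximal)
  moreover have "inverse ?u \<in> A"
    unfolding A_def using V_1 by (intro CollectI exI[of _ 1]) (auto intro!: exI[of _ 1] simp: field_simps)
  ultimately show "inverse ?u \<in> V"
    by simp
qed

definition R :: "nat \<Rightarrow> 'a alg_closure \<Rightarrow> bool" where
  "R n x \<longleftrightarrow> (\<exists>a. (\<forall>i. a i \<in> I) \<and> (\<Sum>i\<le>n. a i * x ^ i) = 1)"

lemma exists_R:
  assumes x: "x \<notin> V"
  shows "\<exists>n. R n x"
proof -
  define A where "A = {poly P x | P. \<forall>i. Polynomial.coeff P i \<in> V}"
  have AI: "poly P x \<in> A" if "\<And>i. Polynomial.coeff P i \<in> V" for P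
    unfolding A_def using that by blast
  have "V \<subseteq> A"
  proof
    fix v assume "v \<in> V"
    then show "v \<in> A"
      using AI[of "[:v:]"] V_0 by (simp add: coeff_pCons split: nat.split)
  qed
  moreover have "x \<in> A"
    using AI[of "[:0, 1:]"] V_0 V_1 by (simp add: coeff_pCons split: nat.split)
  ultimately have "\<not> ext_subring A"
    using maximal x by blast
  moreover have "y - z \<in> A \<and> y * z \<in> A" if yz: "y \<in> A" "z \<in> A" for y z
  proof -
    obtain P Q where *: "y = poly P x" "z = poly Q x" "\<And>i. Polynomial.coeff P i \<in> V" "\<And>i. Polynomial.coeff Q i \<in> V"
      using yz unfolding A_def by auto
    have "y - z = poly (P - Q) x" "y * z = poly (P * Q) x"
      using * by simp_all
    moreover have "Polynomial.coeff (P - Q) i \<in> V" "Polynomial.coeff (P * Q) i \<in> V" for i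
      using * by (auto simp: coeff_mult intro!: V_diff V_sum V_mult)
    ultimately show ?thesis
      using AI[of "P - Q"] AI[of "P * Q"] by metis
  qed
  moreover have "to_ac c \<in> A" if "absv c \<le> 1" for c
    using that \<open>V \<subseteq> A\<close> to_ac_V_iff by blast
  ultimately obtain c where c: "to_ac c \<in> A" "absv c > 1"
    unfolding ext_subring_def by (meson not_le)
  then obtain P where P: "to_ac c = poly P x" "\<And>i. Polynomial.coeff P i \<in> V"
    unfolding A_def by auto
  have "absv (inverse c) < 1" "c \<noteq> 0"
    using c by (auto simp: absv_inverse inverse_less_1_iff)
  then have "to_ac (inverse c) * Polynomial.coeff P i \<in> I" for i
    using P I_scale by blast
  moreover have "(\<Sum>i\<le>Polynomial.degree P. to_ac (inverse c) * Polynomial.coeff P i * x ^ i) = 1"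
  proof -
    have "(\<Sum>i\<le>Polynomial.degree P. to_ac (inverse c) * Polynomial.coeff P i * x ^ i) = to_ac (inverse c) * poly P x"
      by (simp add: poly_altdef sum_distrib_left mult.assoc)
    also have "\<dots> = 1"
      using \<open>c \<noteq> 0\<close> by (simp flip: P(1))
    finally show ?thesis .
  qed
  ultimately show ?thesis
    unfolding R_def by (intro exI[of _ "Polynomial.degree P"] exI[of _ "\<lambda>i. to_ac (inverse c) * Polynomial.coeff P i"]) auto
qed

lemma R_reduce:
  assumes "R n x" "R m (inverse x)" "m \<le> n" "x \<noteq> 0" "n > 0"
  shows "R (n - 1) x"
proof -
  obtain a where a: "\<And>i. a i \<in> I" "(\<Sum>i\<le>n. a i * x ^ i) = 1"
    using assms(1) unfolding R_def by auto
  obtain b where b: "\<And>i. b i \<in> I" "(\<Sum>i\<le>m. b i * inverse x ^ i) = 1"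
    using assms(2) unfolding R_def by auto
  define b' where "b' i = (if i \<le> m then b i else 0)" for i
  have b': "b' i \<in> I" for i
    using b I_0 by (auto simp: b'_def)
  have "(\<Sum>i\<le>n. b' i * inverse x ^ i) = (\<Sum>i\<le>m. b i * inverse x ^ i)"
    by (rule sum.mono_neutral_cong_right) (use assms(3) in \<open>auto simp: b'_def\<close>)
  then have sb: "(\<Sum>i\<le>n. b' i * inverse x ^ i) = 1"
    using b by simp
  define u where "u = 1 - b' 0"
  have u: "u \<noteq> 0" "inverse u \<in> V"
    using one_minus_I_unit[OF b'[of 0]] by (simp_all add: u_def)
  define B where "B i = b' (n - i) * inverse u" for i
  have B: "B i \<in> I" for i
    unfolding B_def using b' u I_mult by blast
  have "{..n} = insert 0 {Suc 0..n}"
    by auto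
  with sb have "(\<Sum>i=Suc 0..n. b' i * inverse x ^ i) = u"
    by (simp add: u_def algebra_simps)
  then have "u * x ^ n = (\<Sum>i=Suc 0..n. b' i * inverse x ^ i) * x ^ n"
    by simp
  also have "\<dots> = (\<Sum>i=Suc 0..n. b' i * x ^ (n - i))"
    unfolding sum_distrib_right
    by (rule sum.cong) (use assms(4) in \<open>auto simp: power_diff field_simps\<close>)
  also have "\<dots> = (\<Sum>i<n. b' (n - i) * x ^ i)"
    by (rule sum.reindex_bij_witness[of _ "\<lambda>i. n - i" "\<lambda>i. n - i"]) auto
  finally have "x ^ n = inverse u * (\<Sum>i<n. b' (n - i) * x ^ i)"
    using u by (simp add: field_simps)
  also have "\<dots> = (\<Sum>i<n. B i * x ^ i)"
    by (simp add: B_def sum_distrib_left mult_ac)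
  finally have xn: "x ^ n = (\<Sum>i<n. B i * x ^ i)" .
  have "1 = (\<Sum>i<n. a i * x ^ i) + a n * x ^ n"
    using a(2) by (simp flip: lessThan_Suc_atMost)
  also have "\<dots> = (\<Sum>i<n. (a i + a n * B i) * x ^ i)"
    unfolding xn by (simp add: sum_distrib_left sum.distrib algebra_simps)
  finally have "(\<Sum>i\<le>n - 1. (a i + a n * B i) * x ^ i) = 1"
    using assms(5) by (simp flip: lessThan_Suc_atMost)
  moreover have "a i + a n * B i \<in> I" for i
    using a B I_sub_V by (intro I_add I_mult) auto
  ultimately show ?thesis
    unfolding R_def by (intro exI[of _ "\<lambda>i. a i + a n * B i"]) auto
qed

lemma valuation_ring: "x \<in> V \<or> inverse x \<in> V"
proof (rule ccontr)
  assume "\<not> (x \<in> V \<or> inverse x \<in> V)"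
  then have x: "x \<notin> V" "inverse x \<notin> V"
    by auto
  then have x0: "x \<noteq> 0"
    using V_0 by auto
  define n where "n = (LEAST n. R n x)"
  define m where "m = (LEAST n. R n (inverse x))"
  have n: "R n x" "\<And>k. k < n \<Longrightarrow> \<not> R k x"
    unfolding n_def using exists_R[OF x(1)] by (auto intro: LeastI_ex dest: not_less_Least)
  have m: "R m (inverse x)" "\<And>k. k < m \<Longrightarrow> \<not> R k (inverse x)"
    unfolding m_def using exists_R[OF x(2)] by (auto intro: LeastI_ex dest: not_less_Least)
  have R0: "\<not> R 0 y" for y
    unfolding R_def using one_notin_I by (auto, metis)
  have "n > 0" "m > 0"
    using R0 n m by (metis gr0I)+
  then show False
    using R_reduce[of n x m] R_reduce[of m "inverse x" n] n m x0 linear[of m n]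
    by (auto simp: diff_less)
qed

definition U :: "'a alg_closure set" where
  "U = {u. u \<in> V \<and> inverse u \<in> V \<and> u \<noteq> 0}"

lemma U_mult: "u \<in> U \<Longrightarrow> v \<in> U \<Longrightarrow> u * v \<in> U"
  by (auto simp: U_def V_mult)

lemma U_inverse: "u \<in> U \<Longrightarrow> inverse u \<in> U"
  by (auto simp: U_def)

lemma U_1: "1 \<in> U"
  by (simp add: U_def V_1)

lemma U_divide: "u \<in> U \<Longrightarrow> v \<in> U \<Longrightarrow> u / v \<in> U"
  by (simp add: divide_inverse U_mult U_inverse)

lemma U_power: "u \<in> U \<Longrightarrow> u ^ n \<in> U"
  by (induction n) (auto intro: U_mult U_1)

lemma to_ac_U: "to_ac c \<in> U \<Longrightarrow> absv c = 1"
proof -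
  assume "to_ac c \<in> U"
  then have "absv c \<le> 1" "inverse (absv c) \<le> 1" "c \<noteq> 0"
    using to_ac_V_iff[of c] to_ac_V_iff[of "inverse c"] by (auto simp: U_def absv_inverse)
  moreover from \<open>c \<noteq> 0\<close> have "absv c > 0" by simp
  ultimately show ?thesis
    by (simp add: field_simps)
qed

lemma nonunit_add:
  assumes "a \<in> V - U" "b \<in> V - U"
  shows "a + b \<in> V - U"
proof -
  have *: "a + b \<notin> U" if "a \<in> V - U" "b \<in> V - U" "b \<noteq> 0" "a / b \<in> V" for a b
  proof
    assume "a + b \<in> U"
    then have "a + b \<noteq> 0" "inverse (a + b) \<in> V"
      by (auto simp: U_def)
    moreover from this have "inverse b = (a / b + 1) * inverse (a + b)"
      using that by (simp add: field_simps)
    ultimately have "inverse b \<in> V"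
      using that V_mult V_add V_1 by metis
    with that show False
      by (auto simp: U_def)
  qed
  have "a + b \<notin> U"
  proof (cases "a = 0 \<or> b = 0")
    case False
    then show ?thesis
      using *[of a b] *[of b a] assms valuation_ring[of "a / b"] by (auto simp: add.commute)
  qed (use assms in auto)
  with assms show ?thesis
    by (auto intro: V_add)
qed

lemma nonunit_sum:
  assumes "finite S" "\<And>i. i \<in> S \<Longrightarrow> f i \<in> V - U"
  shows "sum f S \<in> V - U"
  using assms by (induction S rule: finite_induct) (use nonunit_add V_0 in \<open>auto simp: U_def\<close>)

lemma exists_dominating:
  assumes "finite S" "S \<noteq> {}" "\<And>i. i \<in> S \<Longrightarrow> t i \<noteq> 0"
  shows "\<exists>i\<in>S. \<forall>j\<in>S. t j / t i \<in> V"
  using assms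
proof (induction S rule: finite_ne_induct)
  case (singleton x)
  then show ?case by (simp add: V_1)
next
  case (insert x S)
  then obtain i where i: "i \<in> S" "\<And>j. j \<in> S \<Longrightarrow> t j / t i \<in> V"
    by auto
  have nz: "t x \<noteq> 0" "t i \<noteq> 0"
    using insert i by auto
  show ?case
  proof (cases "t x / t i \<in> V")
    case True
    then show ?thesis using i by auto
  next
    case False
    then have "t i / t x \<in> V"
      using valuation_ring[of "t x / t i"] by simp
    moreover have "t j / t x = (t j / t i) * (t i / t x)" for j
      using nz by simp
    ultimately have "t j / t x \<in> V" if "j \<in> S" for j
      using i that V_mult by metis
    then show ?thesis
      using nz by (auto simp: V_1)
  qed
qed

definition W :: "'a alg_closure \<Rightarrow> 'a \<Rightarrow> nat \<Rightarrow> bool" where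
  "W x c b \<longleftrightarrow> b > 0 \<and> c \<noteq> 0 \<and> x ^ b / to_ac c \<in> U"

lemma exists_W:
  assumes "x \<noteq> 0"
  shows "\<exists>c b. W x c b"
proof -
  obtain p :: "'a poly" where p: "p \<noteq> 0" "poly (map_poly to_ac p) x = 0"
    using alg_closure_algebraic by blast
  define T where "T = {i. i \<le> Polynomial.degree p \<and> Polynomial.coeff p i \<noteq> 0}"
  define t where "t i = to_ac (Polynomial.coeff p i) * x ^ i" for i
  have T: "finite T" "T \<noteq> {}"
    using p(1) unfolding T_def by (auto intro!: exI[of _ "Polynomial.degree p"])
  have t: "t i \<noteq> 0" if "i \<in> T" for i
    using that assms by (simp add: t_def T_def)
  have deg: "Polynomial.degree (map_poly to_ac p) = Polynomial.degree p"
    by (intro degree_map_poly) auto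
  have "0 = (\<Sum>i\<le>Polynomial.degree p. t i)"
    using p(2) by (simp add: poly_altdef deg coeff_map_poly t_def)
  also have "\<dots> = (\<Sum>i\<in>T. t i)"
    by (rule sum.mono_neutral_right) (auto simp: T_def t_def)
  finally have sum0: "(\<Sum>i\<in>T. t i) = 0" ..
  obtain i where i: "i \<in> T" "\<And>j. j \<in> T \<Longrightarrow> t j / t i \<in> V"
    using exists_dominating[of T t] T t by blast
  have "\<exists>j\<in>T - {i}. t j / t i \<in> U"
  proof (rule ccontr)
    assume "\<not> ?thesis"
    then have "(\<Sum>j\<in>T - {i}. t j / t i) \<in> V - U"
      using i T by (intro nonunit_sum) auto
    moreover have "(\<Sum>j\<in>T - {i}. t j / t i) = - 1"
    proof -
      have "(\<Sum>j\<in>T. t j / t i) = 0"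
        using sum0 by (simp flip: sum_divide_distrib)
      then show ?thesis
        using t[OF i(1)] i(1) T(1) by (simp add: sum.remove[of T i] eq_neg_iff_add_eq_0 add.commute)
    qed
    moreover have "- 1 \<in> U"
      using V_diff[OF V_0 V_1] by (simp add: U_def)
    ultimately show False
      by simp
  qed
  then obtain j where j: "j \<in> T" "j \<noteq> i" "t j / t i \<in> U"
    by auto
  have W: "W x (Polynomial.coeff p k / Polynomial.coeff p l) (l - k)" if "k < l" "k \<in> T" "l \<in> T" "t l / t k \<in> U" for k l
  proof -
    have "x ^ (l - k) / to_ac (Polynomial.coeff p k / Polynomial.coeff p l) = t l / t k"
      using that assms by (simp add: t_def T_def power_diff mult.commute)
    with that show ?thesis
      by (simp add: W_def T_def)
  qed
  show ?thesis
  proof (cases "i < j")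
    case True
    then show ?thesis using W[of i j] i j by blast
  next
    case False
    moreover have "t i / t j \<in> U"
      using U_inverse[OF j(3)] by simp
    ultimately show ?thesis
      using W[of j i] i j by (metis linorder_neqE_nat)
  qed
qed

definition ext :: "'a alg_closure \<Rightarrow> real" where
  "ext x = (if x = 0 then 0 else (SOME r. \<exists>c b. W x c b \<and> r = root b (absv c)))"

lemma W_unique:
  assumes "W x c b" "W x c' b'" "x \<noteq> 0"
  shows "root b (absv c) = root b' (absv c')"
proof -
  have b: "b > 0" "b' > 0" "c \<noteq> 0" "c' \<noteq> 0" and "x ^ b / to_ac c \<in> U" "x ^ b' / to_ac c' \<in> U"
    using assms by (auto simp: W_def)
  then have "(x ^ b / to_ac c) ^ b' / (x ^ b' / to_ac c') ^ b \<in> U"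
    using U_divide U_power by blast
  also have "(x ^ b / to_ac c) ^ b' / (x ^ b' / to_ac c') ^ b = to_ac (c' ^ b / c ^ b')"
    using b assms(3) by (simp add: power_divide mult.commute flip: power_mult)
  finally have "absv (c' ^ b / c ^ b') = 1"
    by (rule to_ac_U)
  then have eq: "absv c' ^ b = absv c ^ b'"
    using b by (simp add: absv_divide absv_power)
  have "root b (absv c) ^ (b * b') = absv c ^ b'"
    using b by (simp add: power_mult)
  moreover have "root b' (absv c') ^ (b * b') = absv c' ^ b"
    using b by (simp add: power_mult mult.commute[of b b'])
  ultimately have "root b (absv c) ^ (b * b') = root b' (absv c') ^ (b * b')"
    using eq by simp
  then show ?thesis
    by (rule power_eq_imp_eq_base) (use b in auto)
qed

lemma ext_eq:
  assumes "W x c b" "x \<noteq> 0"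
  shows "ext x = root b (absv c)"
proof -
  have "\<exists>c b. W x c b \<and> ext x = root b (absv c)"
    using assms someI_ex[of "\<lambda>r. \<exists>c b. W x c b \<and> r = root b (absv c)"] unfolding ext_def by auto
  then show ?thesis
    using W_unique[OF assms(1) _ assms(2)] by auto
qed

lemma ext_to_ac: "ext (to_ac c) = absv c"
proof (cases "c = 0")
  case False
  then have "W (to_ac c) c 1"
    by (simp add: W_def U_1)
  from ext_eq[OF this] False show ?thesis by simp
qed (simp add: ext_def)

lemma ext_pos: "x \<noteq> 0 \<Longrightarrow> ext x > 0"
  using exists_W[of x] ext_eq[of x] by (auto simp: W_def)

lemma ext_mult: "ext (x * y) = ext x * ext y"
proof (cases "x = 0 \<or> y = 0")
  case True
  then show ?thesis by (auto simp: ext_def)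
next
  case False
  then obtain c b d e where W: "W x c b" "W y d e"
    using exists_W by metis
  have b: "b > 0" "e > 0" "c \<noteq> 0" "d \<noteq> 0" and "x ^ b / to_ac c \<in> U" "y ^ e / to_ac d \<in> U"
    using W by (auto simp: W_def)
  then have "(x ^ b / to_ac c) ^ e * (y ^ e / to_ac d) ^ b \<in> U"
    using U_mult U_power by blast
  also have "(x ^ b / to_ac c) ^ e * (y ^ e / to_ac d) ^ b = (x * y) ^ (b * e) / to_ac (c ^ e * d ^ b)"
    by (simp add: power_divide power_mult_distrib power_mult[symmetric] mult.commute[of e b])
  finally have "W (x * y) (c ^ e * d ^ b) (b * e)"
    using b by (simp add: W_def)
  then have "ext (x * y) = root (b * e) (absv c ^ e * absv d ^ b)"
    using False by (subst ext_eq) (auto simp: absv_mult absv_power)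
  also have "\<dots> = root b (absv c) * root e (absv d)"
  proof (rule real_root_pos_unique)
    show "(root b (absv c) * root e (absv d)) ^ (b * e) = absv c ^ e * absv d ^ b"
    proof -
      have "root b (absv c) ^ (b * e) = absv c ^ e"
        using b by (simp add: power_mult)
      moreover have "root e (absv d) ^ (b * e) = absv d ^ b"
        using b by (simp add: power_mult mult.commute[of b e])
      ultimately show ?thesis
        by (simp add: power_mult_distrib)
    qed
  qed (use b in auto)
  finally show ?thesis
    using ext_eq[OF W(1)] ext_eq[OF W(2)] False by simp
qed

lemma ext_le_1_iff: "ext x \<le> 1 \<longleftrightarrow> x \<in> V"
proof (cases "x = 0")
  case False
  then obtain c b where W: "W x c b"
    using exists_W by blast
  then have b: "b > 0" "c \<noteq> 0" "x ^ b / to_ac c \<in> V" "to_ac c / x ^ b \<in> V"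
    by (auto simp: W_def U_def)
  have "ext x \<le> 1 \<longleftrightarrow> absv c \<le> 1"
    using ext_eq[OF W False] b by simp
  also have "\<dots> \<longleftrightarrow> x ^ b \<in> V"
    using V_mult[OF b(3), of "to_ac c"] V_mult[OF b(4), of "x ^ b"] to_ac_V_iff[of c] b False by auto
  also have "\<dots> \<longleftrightarrow> x \<in> V"
  proof
    assume xb: "x ^ b \<in> V"
    show "x \<in> V"
    proof (rule ccontr)
      assume "x \<notin> V"
      then have "inverse x \<in> V"
        using valuation_ring by blast
      then have "x ^ b * inverse x ^ (b - 1) \<in> V"
        using xb V_mult V_power by blast
      also have "x ^ b * inverse x ^ (b - 1) = x"
        using b(1) False by (cases b) (simp_all add: power_inverse mult.assoc)
      finally show False
        using \<open>x \<notin> V\<close> by contradiction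
    qed
  qed (rule V_power)
  finally show ?thesis .
qed (simp add: ext_def V_0)

lemma ext_add: "ext (x + y) \<le> max (ext x) (ext y)"
proof -
  have *: "ext (x + y) \<le> ext x" if "ext y \<le> ext x" "x \<noteq> 0" for x y
  proof -
    have "ext x * ext (y / x) \<le> ext x * 1"
      using that by (simp flip: ext_mult)
    then have "ext (y / x) \<le> 1"
      using ext_pos[OF that(2)] by simp
    then have "1 + y / x \<in> V"
      using ext_le_1_iff V_add V_1 by blast
    then have "ext (1 + y / x) \<le> 1"
      using ext_le_1_iff by blast
    then have "ext x * ext (1 + y / x) \<le> ext x * 1"
      using ext_pos[OF that(2)] by (intro mult_left_mono) auto
    then show ?thesis
      using that(2) by (simp flip: ext_mult add: distrib_left)
  qed
  show ?thesis
    using *[of y x] *[of x y] linear[of "ext x" "ext y"]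
    by (cases "x = 0"; cases "y = 0") (auto simp: add.commute max_def)
qed

end

definition is_absv_extension :: "('a::nonarch_field alg_closure \<Rightarrow> real) \<Rightarrow> bool" where
  "is_absv_extension v \<longleftrightarrow>
     (\<forall>c. v (to_ac c) = absv c) \<and>
     (\<forall>x. v x \<ge> 0) \<and> (\<forall>x. v x = 0 \<longleftrightarrow> x = 0) \<and>
     (\<forall>x y. v (x * y) = v x * v y) \<and>
     (\<forall>x y. v (x + y) \<le> max (v x) (v y))"

lemma exists_max_ext_subring: "\<exists>V :: 'a::nonarch_field alg_closure set. max_ext_subring V"
proof -
  let ?S = "{A :: 'a alg_closure set. ext_subring A}"
  have "\<exists>M\<in>?S. \<forall>A\<in>?S. M \<subseteq> A \<longrightarrow> A = M"
  proof (rule subset_Zorn_nonempty)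
    have "ext_subring (to_ac ` {c :: 'a. absv c \<le> 1})"
      unfolding ext_subring_def
    proof (intro conjI allI ballI)
      fix x y :: "'a alg_closure"
      assume "x \<in> to_ac ` {c :: 'a. absv c \<le> 1}" "y \<in> to_ac ` {c :: 'a. absv c \<le> 1}"
      then obtain c d where *: "x = to_ac c" "y = to_ac d" "absv c \<le> 1" "absv d \<le> 1"
        by auto
      then have "absv (c - d) \<le> 1" "absv (c * d) \<le> 1"
        using absv_diff_le_max[of c d] by (auto simp: absv_mult mult_le_one)
      then show "x - y \<in> to_ac ` {c :: 'a. absv c \<le> 1}" "x * y \<in> to_ac ` {c :: 'a. absv c \<le> 1}"
        unfolding * to_ac_diff[symmetric] to_ac_mult[symmetric] by blast+
    qed auto
    then show "?S \<noteq> {}"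
      by blast
  next
    fix C :: "'a alg_closure set set"
    assume C: "C \<noteq> {}" "subset.chain ?S C"
    then have sub: "\<And>A. A \<in> C \<Longrightarrow> ext_subring A"
      and ch: "\<And>A B. A \<in> C \<Longrightarrow> B \<in> C \<Longrightarrow> A \<subseteq> B \<or> B \<subseteq> A"
      by (auto simp: subset_chain_def)
    have "x - y \<in> \<Union>C \<and> x * y \<in> \<Union>C" if xy: "x \<in> \<Union>C" "y \<in> \<Union>C" for x y
    proof -
      obtain A B where "A \<in> C" "B \<in> C" "x \<in> A" "y \<in> B"
        using xy by auto
      then obtain D where D: "D \<in> C" "x \<in> D" "y \<in> D"
        using ch[of A B] by blast
      then have "x - y \<in> D \<and> x * y \<in> D"
        using sub[of D] unfolding ext_subring_def by blast
      with D show ?thesis by blast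
    qed
    moreover have "to_ac c \<in> \<Union>C \<longleftrightarrow> absv c \<le> 1" for c
      using C(1) sub unfolding ext_subring_def by blast
    ultimately show "\<Union>C \<in> ?S"
      unfolding ext_subring_def by blast
  qed
  then show ?thesis
    unfolding max_ext_subring_def by blast
qed

lemma exists_absv_extension: "\<exists>v :: 'a::nonarch_field alg_closure \<Rightarrow> real. is_absv_extension v"
proof -
  obtain V :: "'a alg_closure set" where "max_ext_subring V"
    using exists_max_ext_subring by blast
  then interpret max_ext_subring V .
  have "is_absv_extension ext"
    unfolding is_absv_extension_def
  proof (intro conjI allI)
    fix x y
    show "0 \<le> ext x"
      using ext_pos[of x] by (cases "x = 0") (auto simp: ext_def)
    show "ext x = 0 \<longleftrightarrow> x = 0"
      using ext_pos[of x] by (cases "x = 0") (auto simp: ext_def)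
  qed (simp_all add: ext_to_ac ext_mult ext_add)
  then show ?thesis
    by blast
qed

instantiation alg_closure :: (nonarch_field) nonarch_field
begin

text \<open>
  Over a complete base field, such as the \<open>p\<close>-adic numbers, the extension is unique, so the choice
  is immaterial there.
\<close>

definition absv_alg_closure :: "'a alg_closure \<Rightarrow> real" where
  "absv_alg_closure = (SOME v. is_absv_extension v)"

definition dist_alg_closure :: "'a alg_closure \<Rightarrow> 'a alg_closure \<Rightarrow> real" where
  "dist_alg_closure x y = absv (x - y)"

definition uniformity_alg_closure :: "('a alg_closure \<times> 'a alg_closure) filter" where
  "uniformity_alg_closure = (INF e\<in>{0<..}. principal {(x, y). dist x y < e})"

definition open_alg_closure :: "'a alg_closure set \<Rightarrow> bool" where
  "open_alg_closure U \<longleftrightarrow> (\<forall>x\<in>U. \<forall>\<^sub>F (x', y) in uniformity. x' = x \<longrightarrow> y \<in> U)"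

lemma is_absv_extension_absv: "is_absv_extension (absv :: 'a alg_closure \<Rightarrow> real)"
  unfolding absv_alg_closure_def using exists_absv_extension by (rule someI_ex)

instance
proof
  have ext: "absv x \<ge> 0" "absv x = 0 \<longleftrightarrow> x = 0" "absv (x * y) = absv x * absv y"
      "absv (x + y) \<le> max (absv x) (absv y)" for x y :: "'a alg_closure"
    using is_absv_extension_absv unfolding is_absv_extension_def by blast+
  have "absv (- 1 :: 'a alg_closure) * absv (- 1 :: 'a alg_closure) = 1 * 1"
    using is_absv_extension_absv unfolding is_absv_extension_def
    by (metis absv_1 mult_1 mult_minus1 minus_minus to_ac_1)
  then have m1: "absv (- 1 :: 'a alg_closure) = 1"
    using ext(1)[of "- 1"] by (simp add: square_eq_1_iff)
  have sym: "absv (x - y) = absv (y - x)" for x y :: "'a alg_closure"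
    using ext(3)[of "- 1" "x - y"] m1 by simp
  fix x y z :: "'a alg_closure"
  show "dist x y = absv (x - y)"
    by (rule dist_alg_closure_def)
  show "absv (x * y) = absv x * absv y" "absv (x + y) \<le> max (absv x) (absv y)"
    by (rule ext)+
  show "dist x y = 0 \<longleftrightarrow> x = y"
    by (simp add: dist_alg_closure_def ext)
  show "dist x y \<le> dist x z + dist y z"
    using ext(4)[of "x - z" "z - y"] ext(1)[of "x - z"] ext(1)[of "y - z"] sym[of y z]
    by (simp add: dist_alg_closure_def)
  show "uniformity = (INF e\<in>{0<..}. principal {(x :: 'a alg_closure, y). dist x y < e})"
    by (rule uniformity_alg_closure_def)
  show "open U \<longleftrightarrow> (\<forall>x\<in>U. \<forall>\<^sub>F (x', y) in uniformity. x' = x \<longrightarrow> y \<in> U)" for U :: "'a alg_closure set"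
    by (rule open_alg_closure_def)
qed

end

lemma absv_to_ac [simp]: "absv (to_ac c) = absv c"
  using is_absv_extension_absv unfolding is_absv_extension_def by blast

section \<open>The \<open>p\<close>-adic numbers, the \<open>p\<close>-adic integers and \<open>\<complex>\<^sub>p\<close>\<close>

definition rat_padic_absv :: "nat \<Rightarrow> rat \<Rightarrow> real" where
  "rat_padic_absv p x = (if x = 0 then 0 else
     (case quotient_of x of (a, b) \<Rightarrow>
        real p powi (int (multiplicity (int p) b) - int (multiplicity (int p) a))))"

lemma rat_padic_absv_frac:
  assumes p: "Factorial_Ring.prime p" and "a \<noteq> 0" "b \<noteq> 0"
  shows "rat_padic_absv p (of_int a / of_int b) =
    real p powi (int (multiplicity (int p) b) - int (multiplicity (int p) a))"
proof -
  obtain c d where cd: "quotient_of (of_int a / of_int b) = (c, d)"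
    by fastforce
  have "d > 0" and eq: "of_int a / of_int b = (of_int c / of_int d :: rat)"
    using quotient_of_denom_pos[OF cd] quotient_of_div[OF cd] by auto
  then have "(of_int (a * d) :: rat) = of_int (c * b)"
    using assms by (simp add: field_simps)
  then have ad: "a * d = c * b"
    by (simp only: of_int_eq_iff)
  then have c: "c \<noteq> 0"
    using assms \<open>d > 0\<close> by auto
  have "prime_elem (int p)"
    using p by simp
  then have "multiplicity (int p) a + multiplicity (int p) d = multiplicity (int p) c + multiplicity (int p) b"
    using ad assms c \<open>d > 0\<close> by (metis less_irrefl prime_elem_multiplicity_mult_distrib)
  then have "int (multiplicity (int p) d) - int (multiplicity (int p) c) =
      int (multiplicity (int p) b) - int (multiplicity (int p) a)"
    by linarith
  then show ?thesis
    using assms cd by (simp add: rat_padic_absv_def)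
qed

lemma rat_as_frac:
  fixes x :: rat
  assumes "x \<noteq> 0"
  obtains a b :: int where "a \<noteq> 0" "b \<noteq> 0" "x = of_int a / of_int b"
proof -
  obtain a b where "quotient_of x = (a, b)"
    by fastforce
  then show thesis
    using assms that[of a b] quotient_of_denom_pos[of x a b] quotient_of_div[of x a b] by auto
qed

lemma rat_padic_absv_mult:
  assumes p: "Factorial_Ring.prime p"
  shows "rat_padic_absv p (x * y) = rat_padic_absv p x * rat_padic_absv p y"
proof (cases "x = 0 \<or> y = 0")
  case False
  obtain a b where ab: "a \<noteq> 0" "b \<noteq> 0" "x = of_int a / of_int b"
    using rat_as_frac[of x] False by blast
  obtain c d where cd: "c \<noteq> 0" "d \<noteq> 0" "y = of_int c / of_int d"
    using rat_as_frac[of y] False by blast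
  have xy: "x * y = of_int (a * c) / of_int (b * d)"
    by (simp add: ab cd)
  have "prime_elem (int p)" "p \<noteq> 0"
    using p by auto
  then show ?thesis
    unfolding xy using ab cd
    by (subst rat_padic_absv_frac[OF p])
       (auto simp: ab(3) cd(3) rat_padic_absv_frac[OF p] prime_elem_multiplicity_mult_distrib
          algebra_simps simp flip: power_int_add)
qed (auto simp: rat_padic_absv_def)

lemma rat_padic_absv_0: "rat_padic_absv p 0 = 0"
  by (simp add: rat_padic_absv_def)

lemma rat_padic_absv_nonneg: "rat_padic_absv p x \<ge> 0"
  by (auto simp: rat_padic_absv_def split: prod.split)

lemma rat_padic_absv_eq_0_iff: "Factorial_Ring.prime p \<Longrightarrow> rat_padic_absv p x = 0 \<longleftrightarrow> x = 0"
  by (auto simp: rat_padic_absv_def prime_gt_0_nat split: prod.split)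

lemma rat_padic_absv_add:
  assumes p: "Factorial_Ring.prime p"
  shows "rat_padic_absv p (x + y) \<le> max (rat_padic_absv p x) (rat_padic_absv p y)"
proof (cases "x = 0 \<or> y = 0 \<or> x + y = 0")
  case False
  obtain a b where ab: "a \<noteq> 0" "b \<noteq> 0" "x = of_int a / of_int b"
    using rat_as_frac[of x] False by blast
  obtain c d where cd: "c \<noteq> 0" "d \<noteq> 0" "y = of_int c / of_int d"
    using rat_as_frac[of y] False by blast
  define u v w where "u = a * d" and "v = c * b" and "w = b * d"
  have nz: "u \<noteq> 0" "v \<noteq> 0" "w \<noteq> 0"
    using ab cd by (auto simp: u_def v_def w_def)
  have x: "x = of_int u / of_int w" and y: "y = of_int v / of_int w"
    using ab cd by (simp_all add: u_def v_def w_def)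
  have xy: "x + y = of_int (u + v) / of_int w"
    by (simp add: x y add_divide_distrib)
  with False have uv: "u + v \<noteq> 0"
    by auto
  define m where "m z = multiplicity (int p) z" for z
  have "\<not> is_unit (int p)"
    using p by (metis not_prime_unit of_nat_dvd_iff one_dvd prime_nat_int_transfer)
  then have "m (u + v) \<ge> min (m u) (m v)"
    unfolding m_def using uv nz
    by (intro multiplicity_geI dvd_add) (auto intro: multiplicity_dvd')
  then have "int (m w) - int (m (u + v)) \<le> max (int (m w) - int (m u)) (int (m w) - int (m v))"
    by linarith
  then have "real p powi (int (m w) - int (m (u + v))) \<le>
      real p powi (max (int (m w) - int (m u)) (int (m w) - int (m v)))"
    using prime_gt_0_nat[OF p] by (intro power_int_increasing) auto
  also have "\<dots> \<le> max (real p powi (int (m w) - int (m u))) (real p powi (int (m w) - int (m v)))"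
    by (simp add: max_def)
  finally show ?thesis
    unfolding xy unfolding x y m_def using nz uv by (simp add: rat_padic_absv_frac[OF p] del: of_int_add)
qed (auto simp: rat_padic_absv_0 rat_padic_absv_nonneg le_max_iff_disj)

text \<open>
  The rational numbers with the \<open>p\<close>-adic absolute value, where \<open>p = CARD('p)\<close>.  The phantom
  parameter \<open>'p\<close> of sort \<open>prime_card\<close> ranges over all primes.
\<close>

typedef 'p prat = "UNIV :: rat set" ..

setup_lifting type_definition_prat

instantiation prat :: (type) field
begin

lift_definition zero_prat :: "'a prat" is 0 .
lift_definition one_prat :: "'a prat" is 1 .
lift_definition plus_prat :: "'a prat \<Rightarrow> 'a prat \<Rightarrow> 'a prat" is "(+)" .
lift_definition minus_prat :: "'a prat \<Rightarrow> 'a prat \<Rightarrow> 'a prat" is "(-)" .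
lift_definition uminus_prat :: "'a prat \<Rightarrow> 'a prat" is uminus .
lift_definition times_prat :: "'a prat \<Rightarrow> 'a prat \<Rightarrow> 'a prat" is "(*)" .
lift_definition inverse_prat :: "'a prat \<Rightarrow> 'a prat" is inverse .
lift_definition divide_prat :: "'a prat \<Rightarrow> 'a prat \<Rightarrow> 'a prat" is "(/)" .

instance
  by standard (transfer; simp add: algebra_simps divide_inverse)+

end

instantiation prat :: (prime_card) nonarch_field
begin

lift_definition absv_prat :: "'a prat \<Rightarrow> real" is "rat_padic_absv CARD('a)" .

definition dist_prat :: "'a prat \<Rightarrow> 'a prat \<Rightarrow> real" where
  "dist_prat x y = absv (x - y)"

definition uniformity_prat :: "('a prat \<times> 'a prat) filter" where
  "uniformity_prat = (INF e\<in>{0<..}. principal {(x, y). dist x y < e})"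

definition open_prat :: "'a prat set \<Rightarrow> bool" where
  "open_prat U \<longleftrightarrow> (\<forall>x\<in>U. \<forall>\<^sub>F (x', y) in uniformity. x' = x \<longrightarrow> y \<in> U)"

instance
proof
  have ext: "absv x \<ge> 0" "absv x = 0 \<longleftrightarrow> x = 0" "absv (x * y) = absv x * absv y"
      "absv (x + y) \<le> max (absv x) (absv y)" for x y :: "'a prat"
    by (transfer; simp add: rat_padic_absv_nonneg rat_padic_absv_eq_0_iff rat_padic_absv_mult
          rat_padic_absv_add prime_card)+
  have "absv (1 :: 'a prat) * absv (1 :: 'a prat) = absv (1 :: 'a prat)"
    using ext(3)[of 1 1] by simp
  then have 1: "absv (1 :: 'a prat) = 1"
    using ext(2)[of 1] by simp
  have "absv (- 1 :: 'a prat) * absv (- 1 :: 'a prat) = 1"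
    using ext(3)[of "- 1" "- 1"] 1 by simp
  then have m1: "absv (- 1 :: 'a prat) = 1"
    using ext(1)[of "- 1"] by (simp add: square_eq_1_iff)
  have sym: "absv (x - y) = absv (y - x)" for x y :: "'a prat"
    using ext(3)[of "- 1" "x - y"] m1 by simp
  fix x y z :: "'a prat"
  show "dist x y = absv (x - y)"
    by (rule dist_prat_def)
  show "absv (x * y) = absv x * absv y" "absv (x + y) \<le> max (absv x) (absv y)"
    by (rule ext)+
  show "dist x y = 0 \<longleftrightarrow> x = y"
    by (simp add: dist_prat_def ext)
  show "dist x y \<le> dist x z + dist y z"
    using ext(4)[of "x - z" "z - y"] ext(1)[of "x - z"] ext(1)[of "y - z"] sym[of y z]
    by (simp add: dist_prat_def)
  show "uniformity = (INF e\<in>{0<..}. principal {(x :: 'a prat, y). dist x y < e})"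
    by (rule uniformity_prat_def)
  show "open U \<longleftrightarrow> (\<forall>x\<in>U. \<forall>\<^sub>F (x', y) in uniformity. x' = x \<longrightarrow> y \<in> U)" for U :: "'a prat set"
    by (rule open_prat_def)
qed

end

lemma Rep_prat_of_nat: "Rep_prat (of_nat n) = of_nat n"
  by (induction n) (simp_all add: zero_prat.rep_eq one_prat.rep_eq plus_prat.rep_eq)

lemma absv_prat_card: "absv (of_nat CARD('p) :: 'p::prime_card prat) = 1 / real CARD('p)"
proof -
  have "rat_padic_absv CARD('p) (of_int (int CARD('p)) / of_int 1) = 1 / real CARD('p)"
    using prime_card[where 'a = 'p]
    by (subst rat_padic_absv_frac) (auto simp: power_int_minus field_simps)
  then show ?thesis
    by (simp add: absv_prat.rep_eq Rep_prat_of_nat)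
qed

type_synonym 'p padic = "'p prat completion"

type_synonym 'p Cp = "'p padic alg_closure completion"

lemma absv_Cp_card: "absv (of_nat CARD('p) :: 'p::prime_card Cp) = 1 / real CARD('p)"
  by (metis absv_prat_card absv_to_ac absv_to_completion to_ac_of_nat to_completion_of_nat)

typedef (overloaded) 'p padic_int = "{x :: 'p::prime_card padic. absv x \<le> 1}"
  by (intro exI[of _ 0]) simp

setup_lifting type_definition_padic_int

instantiation padic_int :: (prime_card) comm_ring_1
begin

lift_definition zero_padic_int :: "'a padic_int" is 0
  by simp
lift_definition one_padic_int :: "'a padic_int" is 1
  by simp
lift_definition plus_padic_int :: "'a padic_int \<Rightarrow> 'a padic_int \<Rightarrow> 'a padic_int" is "(+)"
  by (meson absv_add_le_max max.boundedI order_trans)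
lift_definition minus_padic_int :: "'a padic_int \<Rightarrow> 'a padic_int \<Rightarrow> 'a padic_int" is "(-)"
  by (meson absv_diff_le_max max.boundedI order_trans)
lift_definition uminus_padic_int :: "'a padic_int \<Rightarrow> 'a padic_int" is uminus
  by simp
lift_definition times_padic_int :: "'a padic_int \<Rightarrow> 'a padic_int \<Rightarrow> 'a padic_int" is "(*)"
  by (simp add: absv_mult mult_le_one)

instance
  by standard (transfer; simp add: algebra_simps)+

end

section \<open>The \<open>q\<close>-integral and the Carlitz \<open>q\<close>-Bernoulli numbers\<close>

definition of_padic_int :: "'p::prime_card padic_int \<Rightarrow> 'p Cp" where
  "of_padic_int x = to_completion (to_ac (Rep_padic_int x))"

text \<open>
  \<open>q\<^sup>x\<close> for a \<open>p\<close>-adic integer \<open>x\<close> is the limit of \<open>q\<^sup>m\<close> as the natural number \<open>m\<close> tends to \<open>x\<close>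
  \<open>p\<close>-adically; it exists if \<open>absv (1 - q) < 1\<close>.
\<close>

definition padic_power :: "'p::prime_card Cp \<Rightarrow> 'p padic_int \<Rightarrow> 'p Cp" where
  "padic_power q x = Lim (filtercomap of_nat (nhds (Rep_padic_int x))) (\<lambda>m. q ^ m)"

text \<open>At \<open>q = 1\<close>, where the quotient is \<open>0 / 0\<close>, the value is the usual limiting one.\<close>

definition q_number :: "'p::prime_card Cp \<Rightarrow> 'p padic_int \<Rightarrow> 'p Cp" where
  "q_number q x = (if q = 1 then of_padic_int x else (1 - padic_power q x) / (1 - q))"

definition q_bernstein ::
    "'p::prime_card Cp \<Rightarrow> nat \<Rightarrow> nat \<Rightarrow> 'p padic_int \<Rightarrow> 'p padic_int \<Rightarrow> 'p Cp" where
  "q_bernstein q k n x1 x2 =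
     (if n \<ge> k then of_nat (n choose k) * q_number q x1 ^ k * q_number (inverse q) (1 - x2) ^ (n - k)
      else 0)"

definition q_integral :: "'p::prime_card Cp \<Rightarrow> ('p padic_int \<Rightarrow> 'p Cp) \<Rightarrow> 'p Cp" where
  "q_integral q f = lim (\<lambda>N. 1 / q_number q (of_nat (CARD('p) ^ N)) *
     (\<Sum>x<CARD('p) ^ N. f (of_nat x) * q ^ x))"

definition is_carlitz_bernoulli :: "'a::field \<Rightarrow> (nat \<Rightarrow> 'a) \<Rightarrow> bool" where
  "is_carlitz_bernoulli q \<beta> \<longleftrightarrow> \<beta> 0 = 1 \<and>
     (\<forall>k\<ge>1. q * (\<Sum>i\<le>k. of_nat (k choose i) * q ^ i * \<beta> i) - \<beta> k = (if k = 1 then 1 else 0))"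

text \<open>
  The recurrence has exactly one solution unless \<open>q\<close> is a root of unity other than \<open>1\<close> (at \<open>q = 1\<close> it
  gives the Bernoulli numbers, the relation for \<open>k\<close> then determining \<open>\<beta> (k - 1)\<close>).
\<close>

definition carlitz_bernoulli :: "'a::field \<Rightarrow> nat \<Rightarrow> 'a" where
  "carlitz_bernoulli q = (THE \<beta>. is_carlitz_bernoulli q \<beta>)"

end

theory Submission
  imports Defs
begin

text \<open>
  Write \<open>[n] = 1 + q + \<dots> + q\<^sup>n\<^sup>-\<^sup>1\<close> and let \<open>n = p\<^sup>N\<close>, so that \<open>[n] \<rightarrow> 0\<close>.  The \<open>q\<close>-integral is the limit of the
  weighted means of \<open>f\<close> over \<open>0, \<dots>, n - 1\<close>.  Because \<open>[x + 1] = 1 + q [x]\<close>, telescoping shows that the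
  means of \<open>[x]\<^sup>k\<close> satisfy the Carlitz recurrence up to an error term \<open>[n]\<^sup>k\<^sup>-\<^sup>1 q\<^sup>n\<close>; solving the recurrence
  gives convergence of the means to \<open>\<beta>\<^sub>k\<close>.  For the second factor, the exact substitution
  \<open>x = n - 1 - y\<close> turns the \<open>q\<close>-mean of \<open>[1 - x]\<^sup>m\<close> to base \<open>r = 1/q\<close> into the \<open>r\<close>-mean of \<open>[y + 2 - n]\<^sup>m\<close>.
  In the limit \<open>n\<close> may be dropped, and shifting the argument by \<open>2\<close> adds boundary terms, which produce
  \<open>m + 1 - q\<close>.
\<close>

section \<open>Limits in non-archimedean fields\<close>

lemma tendsto_absv_iff:
  fixes l :: "'a::nonarch_field"
  shows "(f \<longlongrightarrow> l) F \<longleftrightarrow> ((\<lambda>x. absv (f x - l)) \<longlongrightarrow> 0) F"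
  using tendsto_dist_iff[of f l F] by (simp add: dist_absv)

text \<open>With this instance and the multiplicative one below, \<open>tendsto_intros\<close>
  handles polynomial expressions in any such field, in particular in \<open>'p Cp\<close>.\<close>

instance nonarch_field < topological_ab_group_add
proof
  fix a b :: 'a
  have "((\<lambda>x. absv (fst x - a) + absv (snd x - b)) \<longlongrightarrow> 0 + 0) (nhds a \<times>\<^sub>F nhds b)"
    using filterlim_fst[of "nhds a" "nhds b"] filterlim_snd[of "nhds b" "nhds a"]
    by (intro tendsto_add) (simp_all add: tendsto_absv_iff)
  then have lim: "((\<lambda>x. absv (fst x - a) + absv (snd x - b)) \<longlongrightarrow> 0) (nhds a \<times>\<^sub>F nhds b)"
    by simp
  have "absv (x + y - (a + b)) \<le> absv (x - a) + absv (y - b)" for x y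
    using absv_add_le[of "x - a" "y - b"] by (simp add: algebra_simps)
  then show "LIM x (nhds a \<times>\<^sub>F nhds b). fst x + snd x :> nhds (a + b)"
    unfolding tendsto_absv_iff
    by (intro Lim_null_comparison[OF _ lim]) (auto intro!: always_eventually)
  have "((\<lambda>x. x) \<longlongrightarrow> a) (nhds a)"
    by (rule filterlim_ident)
  then show "(uminus \<longlongrightarrow> - a) (nhds a)"
    unfolding tendsto_absv_iff by (simp add: absv_minus_commute)
qed

instance nonarch_field < topological_comm_monoid_mult
proof
  fix a b :: 'a
  have *: "((\<lambda>x. absv (fst x - a)) \<longlongrightarrow> 0) (nhds a \<times>\<^sub>F nhds b)"
      "((\<lambda>x. absv (snd x - b)) \<longlongrightarrow> 0) (nhds a \<times>\<^sub>F nhds b)"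
    using filterlim_fst[of "nhds a" "nhds b"] filterlim_snd[of "nhds b" "nhds a"]
    by (simp_all add: tendsto_absv_iff)
  have "((\<lambda>x. (absv (fst x - a) + absv a) * absv (snd x - b) + absv b * absv (fst x - a))
      \<longlongrightarrow> (0 + absv a) * 0 + absv b * 0) (nhds a \<times>\<^sub>F nhds b)"
    by (intro tendsto_intros *)
  then have lim: "((\<lambda>x. (absv (fst x - a) + absv a) * absv (snd x - b) + absv b * absv (fst x - a))
      \<longlongrightarrow> 0) (nhds a \<times>\<^sub>F nhds b)"
    by simp
  have "absv (x * y - a * b) \<le> (absv (x - a) + absv a) * absv (y - b) + absv b * absv (x - a)" for x y
    using absv_add_le[of "x - a" a] by (intro absv_mult_diff_le) auto
  then show "LIM x (nhds a \<times>\<^sub>F nhds b). fst x * snd x :> nhds (a * b)"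
    unfolding tendsto_absv_iff
    by (intro Lim_null_comparison[OF _ lim]) (auto intro!: always_eventually)
qed

lemma absv_sum_le:
  fixes f :: "'b \<Rightarrow> 'a::nonarch_field"
  assumes "\<And>i. i \<in> I \<Longrightarrow> absv (f i) \<le> B" "B \<ge> 0"
  shows "absv (\<Sum>i\<in>I. f i) \<le> B"
  using assms(1)
proof (induction I rule: infinite_finite_induct)
  case (insert i I)
  then have "absv (f i) \<le> B" "absv (\<Sum>i\<in>I. f i) \<le> B"
    by auto
  with insert.hyps absv_add_le_max[of "f i" "\<Sum>i\<in>I. f i"] show ?case
    by simp
qed (use assms(2) in auto)

text \<open>The ultrametric inequality is applied to q = 1 - (1 - q) and to 1 = q + (1 - q).\<close>

lemma absv_eq_1_of_near_1:
  fixes q :: "'a::nonarch_field"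
  assumes "absv (1 - q) < 1"
  shows "absv q = 1"
  using absv_diff_le_max[of 1 "1 - q"] absv_add_le_max[of q "1 - q"] assms by auto

section \<open>\<open>q\<close>-brackets of natural numbers and \<open>q\<close>-means\<close>

text \<open>The sum form of (1 - q^n) / (1 - q) includes q = 1 and needs no division.\<close>

definition q_bracket :: "'a::comm_semiring_1 \<Rightarrow> nat \<Rightarrow> 'a" where
  "q_bracket q n = (\<Sum>i<n. q ^ i)"

lemma q_bracket_0 [simp]: "q_bracket q 0 = 0"
  by (simp add: q_bracket_def)

lemma q_bracket_one [simp]: "q_bracket 1 n = of_nat n"
  by (simp add: q_bracket_def)

lemma q_bracket_Suc: "q_bracket q (Suc n) = q_bracket q n + q ^ n"
  by (simp add: q_bracket_def add.commute)

lemma q_bracket_add: "q_bracket q (m + n) = q_bracket q m + q ^ m * q_bracket q n"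
  by (induction n) (simp_all add: q_bracket_Suc power_add algebra_simps)

lemma q_bracket_Suc': "q_bracket q (Suc n) = 1 + q * q_bracket q n"
  using q_bracket_add[of q 1 n] by (simp add: q_bracket_Suc)

lemma q_bracket_mult: "q_bracket q (m * n) = q_bracket q m * q_bracket (q ^ m) n"
  by (induction n) (simp_all add: q_bracket_Suc' q_bracket_add algebra_simps)

text \<open>The two recursions for [n + 1] must agree. As q^n is affine in [n], the limit [n] -> 0
  forces q^n -> 1.\<close>

lemma power_eq_q_bracket:
  fixes q :: "'a::comm_ring_1"
  shows "q ^ n = 1 - (1 - q) * q_bracket q n"
  using q_bracket_Suc[of q n] q_bracket_Suc'[of q n] by (simp add: algebra_simps)

lemma q_bracket_eq_divide:
  fixes q :: "'a::field"
  assumes "q \<noteq> 1"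
  shows "q_bracket q n = (1 - q ^ n) / (1 - q)"
  using assms power_eq_q_bracket[of q n] by simp

lemma q_bracket_inverse:
  fixes r :: "'a::field"
  assumes "r \<noteq> 0"
  shows "q_bracket (inverse r) n * r ^ n = r * q_bracket r n"
proof (induction n)
  case (Suc n)
  have "q_bracket (inverse r) (Suc n) * r ^ Suc n = r * r ^ n + q_bracket (inverse r) n * r ^ n"
    using assms by (simp add: q_bracket_Suc' field_simps)
  then show ?case
    unfolding Suc q_bracket_Suc by (simp add: algebra_simps)
qed simp

lemma q_bracket_nonzero:
  fixes q :: "'a::field"
  assumes "\<forall>m>0. q ^ m = 1 \<longrightarrow> q = 1" "of_nat n \<noteq> (0::'a)" "n > 0"
  shows "q_bracket q n \<noteq> 0"
  using assms by (cases "q = 1") (auto simp: q_bracket_eq_divide)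

lemma absv_q_bracket_le:
  fixes q :: "'a::nonarch_field"
  assumes "absv q \<le> 1"
  shows "absv (q_bracket q n) \<le> 1"
  unfolding q_bracket_def
  by (rule absv_sum_le) (use assms in \<open>auto simp: absv_power power_le_one\<close>)

lemma absv_power_minus_1_le:
  fixes q :: "'a::nonarch_field"
  assumes "absv q \<le> 1"
  shows "absv (1 - q ^ n) \<le> absv (1 - q)"
proof -
  have "absv (1 - q ^ n) = absv (1 - q) * absv (q_bracket q n)"
    by (simp add: power_eq_q_bracket absv_mult)
  also have "\<dots> \<le> absv (1 - q)"
    using absv_q_bracket_le[OF assms, of n] by (simp add: mult_left_le)
  finally show ?thesis .
qed

text \<open>Passing from p^N to p^(N+1) multiplies the bracket by [p] to base q^(p^N). This factor
  differs from p by a sum of terms 1 - q^i, so its absolute value is at most c < 1 and the decay is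
  geometric.\<close>

lemma q_bracket_prime_power_tendsto_0:
  fixes q :: "'a::nonarch_field"
  assumes q: "absv (1 - q) < 1" and p: "absv (of_nat p :: 'a) < 1"
  shows "(\<lambda>N. q_bracket q (p ^ N)) \<longlonglongrightarrow> 0"
proof -
  define c where "c = max (absv (of_nat p :: 'a)) (absv (1 - q))"
  have c: "0 \<le> c" "c < 1"
    using q p by (auto simp: c_def le_max_iff_disj)
  have q1: "absv q = 1"
    by (rule absv_eq_1_of_near_1[OF q])
  have step: "absv (q_bracket (q ^ m) p) \<le> c" for m
  proof -
    have "q_bracket (q ^ m) p = of_nat p - (\<Sum>i<p. 1 - q ^ (m * i))"
      unfolding q_bracket_def sum_subtractf power_mult by simp
    also have "absv \<dots> \<le> max (absv (of_nat p :: 'a)) (absv (\<Sum>i<p. 1 - q ^ (m * i)))"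
      by (rule absv_diff_le_max)
    also have "\<dots> \<le> c"
      unfolding c_def
      by (intro max.mono order.refl absv_sum_le absv_power_minus_1_le) (auto simp: q1)
    finally show ?thesis .
  qed
  have "absv (q_bracket q (p ^ N)) \<le> c ^ N" for N
  proof (induction N)
    case (Suc N)
    have "absv (q_bracket q (p ^ Suc N)) = absv (q_bracket q (p ^ N)) * absv (q_bracket (q ^ p ^ N) p)"
      by (simp only: power_Suc2 q_bracket_mult absv_mult)
    also have "\<dots> \<le> c ^ N * c"
      using Suc step c by (intro mult_mono) auto
    finally show ?case
      by (simp add: mult.commute)
  qed (simp add: q_bracket_def)
  then have "\<forall>\<^sub>F N in sequentially. norm (absv (q_bracket q (p ^ N) - 0)) \<le> c ^ N"
    by simp
  then show ?thesis
    unfolding tendsto_absv_iff using c by (rule Lim_null_comparison[OF _ LIMSEQ_realpow_zero])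
qed

lemma power_prime_power_tendsto_1:
  fixes q :: "'a::nonarch_field"
  assumes "absv (1 - q) < 1" "absv (of_nat p :: 'a) < 1"
  shows "(\<lambda>N. q ^ p ^ N) \<longlonglongrightarrow> 1"
proof -
  have "(\<lambda>N. 1 - (1 - q) * q_bracket q (p ^ N)) \<longlonglongrightarrow> 1 - (1 - q) * 0"
    by (intro tendsto_intros q_bracket_prime_power_tendsto_0 assms)
  then show ?thesis
    by (simp flip: power_eq_q_bracket)
qed

text \<open>The expression under the limit in \<open>q_integral\<close>, for arbitrary length n. The
  weights q^x / [n] sum to 1 if [n] is nonzero.\<close>

definition q_mean :: "'a::field \<Rightarrow> (nat \<Rightarrow> 'a) \<Rightarrow> nat \<Rightarrow> 'a" where
  "q_mean q f n = (\<Sum>x<n. f x * q ^ x) / q_bracket q n"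

lemma q_mean_const:
  "q_bracket q n \<noteq> 0 \<Longrightarrow> q_mean q (\<lambda>x. c) n = c"
  by (simp add: q_mean_def q_bracket_def flip: sum_distrib_left)

lemma q_mean_cmult: "q_mean q (\<lambda>x. c * f x) n = c * q_mean q f n"
  by (simp add: q_mean_def sum_distrib_left mult.assoc)

lemma q_mean_sum: "q_mean q (\<lambda>x. \<Sum>i\<in>I. f i x) n = (\<Sum>i\<in>I. q_mean q (f i) n)"
  unfolding q_mean_def sum_distrib_right sum_divide_distrib by (rule sum.swap)

text \<open>The defect \<open>q \<integral> f(x + 1) - \<integral> f(x)\<close> of shift invariance is a boundary term.\<close>

lemma q_mean_shift:
  "q * q_mean q (\<lambda>x. f (Suc x)) n = q_mean q f n + (f n * q ^ n - f 0) / q_bracket q n"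
proof -
  have "q * (\<Sum>x<n. f (Suc x) * q ^ x) - (\<Sum>x<n. f x * q ^ x)
      = (\<Sum>x<n. f (Suc x) * q ^ Suc x - f x * q ^ x)"
    by (simp add: sum_subtractf sum_distrib_left mult_ac)
  also have "\<dots> = f n * q ^ n - f 0"
    by (subst sum_lessThan_telescope) simp
  finally have "q * (\<Sum>x<n. f (Suc x) * q ^ x) = (\<Sum>x<n. f x * q ^ x) + (f n * q ^ n - f 0)"
    by (simp add: diff_eq_eq add.commute)
  then show ?thesis
    unfolding q_mean_def times_divide_eq_right add_divide_distrib[symmetric] by (rule arg_cong)
qed

section \<open>The Carlitz recurrence\<close>

text \<open>The right-hand side is left free, so that the finite means, which carry an error term,
  and their limits obey the same kind of relation.\<close>

definition carlitz_rec :: "'a::field \<Rightarrow> (nat \<Rightarrow> 'a) \<Rightarrow> (nat \<Rightarrow> 'a) \<Rightarrow> bool" where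
  "carlitz_rec q b c \<longleftrightarrow> b 0 = c 0 \<and>
     (\<forall>k\<ge>1. q * (\<Sum>i\<le>k. of_nat (k choose i) * q ^ i * b i) - b k = c k)"

lemma is_carlitz_bernoulli_iff_rec:
  "is_carlitz_bernoulli q \<beta> \<longleftrightarrow> carlitz_rec q \<beta> (\<lambda>k. if k \<le> 1 then 1 else 0)"
  unfolding is_carlitz_bernoulli_def carlitz_rec_def
  by (intro arg_cong2[where f = "(\<and>)"] all_cong) auto

text \<open>
  For \<open>q \<noteq> 1\<close> the relation of index \<open>k\<close> determines \<open>b k\<close>; for \<open>q = 1\<close> the terms \<open>b k\<close> cancel in it and
  the relation of index \<open>k + 1\<close> has to be used.  Having the solution as a fixed linear expression
  in \<open>b\<close> and \<open>c\<close> yields both uniqueness and the passage to the limit.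
\<close>

lemma carlitz_rec_solve:
  fixes q :: "'a::field"
  assumes nz: "\<And>m. m > 0 \<Longrightarrow> q_bracket q m \<noteq> 0"
  obtains u w j where "\<And>b c. carlitz_rec q b c \<Longrightarrow> b k = w * c j + (\<Sum>i<k. u i * b i)"
proof (cases "q = 1")
  case True
  define s where "s = (of_nat (Suc k) :: 'a)"
  have s: "s \<noteq> 0"
    using nz[of "Suc k"] True by (simp add: s_def)
  show thesis
  proof (rule that[of "1 / s" "Suc k" "\<lambda>i. - (of_nat (Suc k choose i) / s)"])
    fix b c assume "carlitz_rec q b c"
    then have "(\<Sum>i\<le>Suc k. of_nat (Suc k choose i) * b i) - b (Suc k) = c (Suc k)"
      using True unfolding carlitz_rec_def by force
    then have "s * b k = c (Suc k) - (\<Sum>i<k. of_nat (Suc k choose i) * b i)"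
      by (simp add: s_def lessThan_Suc_atMost[symmetric] algebra_simps)
    then have "b k = (c (Suc k) - (\<Sum>i<k. of_nat (Suc k choose i) * b i)) / s"
      using s by (simp add: field_simps)
    then show "b k = 1 / s * c (Suc k) + (\<Sum>i<k. - (of_nat (Suc k choose i) / s) * b i)"
      by (simp add: diff_divide_distrib sum_divide_distrib sum_negf)
  qed
next
  case False
  show thesis
  proof (cases "k = 0")
    case True
    then show thesis
      by (intro that[of 1 0 "\<lambda>_. 0"]) (simp add: carlitz_rec_def)
  next
    case k: False
    define s where "s = q ^ Suc k - 1"
    have s: "s \<noteq> 0"
      using nz[of "Suc k"] False by (simp add: s_def q_bracket_eq_divide)
    show thesis
    proof (rule that[of "1 / s" k "\<lambda>i. - (q * of_nat (k choose i) * q ^ i / s)"])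
      fix b c assume "carlitz_rec q b c"
      with k have "q * (\<Sum>i\<le>k. of_nat (k choose i) * q ^ i * b i) - b k = c k"
        by (auto simp: carlitz_rec_def)
      then have "s * b k = c k - (\<Sum>i<k. q * of_nat (k choose i) * q ^ i * b i)"
        by (simp add: s_def lessThan_Suc_atMost[symmetric] sum_distrib_left algebra_simps)
      then have "b k = (c k - (\<Sum>i<k. q * of_nat (k choose i) * q ^ i * b i)) / s"
        using s by (simp add: field_simps)
      then show "b k = 1 / s * c k + (\<Sum>i<k. - (q * of_nat (k choose i) * q ^ i / s) * b i)"
        by (simp add: diff_divide_distrib sum_divide_distrib sum_negf)
    qed
  qed
qed

lemma carlitz_rec_unique:
  assumes nz: "\<And>m. m > 0 \<Longrightarrow> q_bracket q m \<noteq> 0"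
    and "carlitz_rec q b c" "carlitz_rec q b' c"
  shows "b = b'"
proof
  show "b k = b' k" for k
  proof (induction k rule: less_induct)
    case (less k)
    obtain u w j where "\<And>b c. carlitz_rec q b c \<Longrightarrow> b k = w * c j + (\<Sum>i<k. u i * b i)"
      using carlitz_rec_solve[OF nz] by metis
    from this[OF assms(2)] this[OF assms(3)] less show ?case
      by simp
  qed
qed

lemma carlitz_bernoulli_eqI:
  assumes "\<And>m. m > 0 \<Longrightarrow> q_bracket q m \<noteq> 0" "is_carlitz_bernoulli q \<beta>"
  shows "carlitz_bernoulli q = \<beta>"
  unfolding carlitz_bernoulli_def
proof (rule the_equality[where P = "is_carlitz_bernoulli q", OF assms(2)])
  show "\<gamma> = \<beta>" if "is_carlitz_bernoulli q \<gamma>" for \<gamma>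
    using carlitz_rec_unique[of q \<gamma> _ \<beta>] assms that unfolding is_carlitz_bernoulli_iff_rec by blast
qed

text \<open>The coefficients of the solved recurrence do not depend on N, so convergence below k
  passes to k; afterwards the limit is taken in the recurrence itself.\<close>

lemma carlitz_rec_limit:
  fixes q :: "'a::nonarch_field"
  assumes nz: "\<And>m. m > 0 \<Longrightarrow> q_bracket q m \<noteq> 0"
    and rec: "\<And>N. carlitz_rec q (b N) (c N)"
    and c: "\<And>k. (\<lambda>N. c N k) \<longlonglongrightarrow> d k"
  obtains \<beta> where "carlitz_rec q \<beta> d" "\<And>k. (\<lambda>N. b N k) \<longlonglongrightarrow> \<beta> k"
proof -
  have conv: "convergent (\<lambda>N. b N k)" for k
  proof (induction k rule: less_induct)
    case (less k)
    then obtain l where l: "\<And>i. i < k \<Longrightarrow> (\<lambda>N. b N i) \<longlonglongrightarrow> l i"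
      unfolding convergent_def by metis
    obtain u w j where "\<And>b c. carlitz_rec q b c \<Longrightarrow> b k = w * c j + (\<Sum>i<k. u i * b i)"
      using carlitz_rec_solve[OF nz] by metis
    note eq = this[OF rec]
    have "(\<lambda>N. w * c N j + (\<Sum>i<k. u i * b N i)) \<longlonglongrightarrow> w * d j + (\<Sum>i<k. u i * l i)"
      by (intro tendsto_intros c l) simp
    then show ?case
      unfolding convergent_def eq by blast
  qed
  then obtain \<beta> where \<beta>: "\<And>k. (\<lambda>N. b N k) \<longlonglongrightarrow> \<beta> k"
    unfolding convergent_def by metis
  have "carlitz_rec q \<beta> d"
    unfolding carlitz_rec_def
  proof (intro conjI allI impI)
    show "\<beta> 0 = d 0"
      using rec \<beta>[of 0] c[of 0] by (simp add: carlitz_rec_def LIMSEQ_unique)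
    fix k :: nat assume k: "k \<ge> 1"
    have "(\<lambda>N. q * (\<Sum>i\<le>k. of_nat (k choose i) * q ^ i * b N i) - b N k)
        \<longlonglongrightarrow> q * (\<Sum>i\<le>k. of_nat (k choose i) * q ^ i * \<beta> i) - \<beta> k"
      by (intro tendsto_intros \<beta>)
    with rec k c show "q * (\<Sum>i\<le>k. of_nat (k choose i) * q ^ i * \<beta> i) - \<beta> k = d k"
      by (auto simp: carlitz_rec_def intro: LIMSEQ_unique)
  qed
  with \<beta> that show thesis
    by blast
qed

text \<open>The binomial expansion of (1 + q [x])^k = [x + 1]^k makes the sum in the recurrence the
  mean of a shifted function. The right-hand side is the boundary term of
  \<open>q_mean_shift\<close>, where [0]^k = 0 for k > 0.\<close>

lemma carlitz_rec_q_mean: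
  assumes n: "q_bracket q n \<noteq> 0"
  shows "carlitz_rec q (\<lambda>k. q_mean q (\<lambda>x. q_bracket q x ^ k) n)
    (\<lambda>k. if k = 0 then 1 else q_bracket q n ^ (k - 1) * q ^ n)"
  unfolding carlitz_rec_def
proof (intro conjI allI impI)
  fix k :: nat assume k: "k \<ge> 1"
  have "(\<Sum>i\<le>k. of_nat (k choose i) * q ^ i * q_mean q (\<lambda>x. q_bracket q x ^ i) n)
      = q_mean q (\<lambda>x. \<Sum>i\<le>k. of_nat (k choose i) * q ^ i * q_bracket q x ^ i) n"
    by (simp add: q_mean_sum q_mean_cmult)
  also have "(\<lambda>x. \<Sum>i\<le>k. of_nat (k choose i) * q ^ i * q_bracket q x ^ i)
      = (\<lambda>x. q_bracket q (Suc x) ^ k)"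
    using binomial_ring[of "q * q_bracket q x" 1 k for x]
    by (simp add: q_bracket_Suc' add.commute power_mult_distrib mult.assoc)
  finally show "q * (\<Sum>i\<le>k. of_nat (k choose i) * q ^ i * q_mean q (\<lambda>x. q_bracket q x ^ i) n)
      - q_mean q (\<lambda>x. q_bracket q x ^ k) n
      = (if k = 0 then 1 else q_bracket q n ^ (k - 1) * q ^ n)"
    using k n q_mean_shift[of q "\<lambda>x. q_bracket q x ^ k" n] by (cases k) auto
qed (simp add: q_mean_const n)

lemma q_mean_moment_tendsto:
  fixes q :: "'a::nonarch_field"
  assumes nz: "\<And>m. m > 0 \<Longrightarrow> q_bracket q m \<noteq> 0"
    and a: "\<And>N. a N > 0" "(\<lambda>N. q_bracket q (a N)) \<longlonglongrightarrow> 0"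
  shows "(\<lambda>N. q_mean q (\<lambda>x. q_bracket q x ^ k) (a N)) \<longlonglongrightarrow> carlitz_bernoulli q k"
proof -
  have "(\<lambda>N. if k = 0 then 1 else q_bracket q (a N) ^ (k - 1) * q ^ a N)
      \<longlonglongrightarrow> (if k \<le> 1 then 1 else 0)" for k
  proof (cases "k = 0")
    case False
    \<comment> \<open>At k = 1 the factor \<open>0 ^ (k - 1)\<close> is 1, which yields the
      exceptional value in the Carlitz recurrence.\<close>
    have "(\<lambda>N. q_bracket q (a N) ^ (k - 1) * (1 - (1 - q) * q_bracket q (a N)))
        \<longlonglongrightarrow> 0 ^ (k - 1) * (1 - (1 - q) * 0)"
      by (intro tendsto_intros a)
    then show ?thesis
      using False by (auto simp: power_0_left simp flip: power_eq_q_bracket)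
  qed simp
  from carlitz_rec_limit[OF nz carlitz_rec_q_mean[OF nz[OF a(1)]] this]
  obtain \<beta> where "carlitz_rec q \<beta> (\<lambda>k. if k \<le> 1 then 1 else 0)"
      and lim: "\<And>k. (\<lambda>N. q_mean q (\<lambda>x. q_bracket q x ^ k) (a N)) \<longlonglongrightarrow> \<beta> k"
    by blast
  then have "carlitz_bernoulli q = \<beta>"
    using carlitz_bernoulli_eqI[of q] nz unfolding is_carlitz_bernoulli_iff_rec by blast
  with lim show ?thesis
    by simp
qed

section \<open>Reflection\<close>

text \<open>
  Here \<open>(1 - q_bracket r x) / r ^ x\<close> is \<open>[1 - x]\<^sub>r\<close>, and the substitution \<open>x = n - 1 - y\<close> turns it into
  \<open>[y + 2 - n]\<^sub>r\<close> while replacing the base \<open>1/r\<close> of the mean by \<open>r\<close>.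
\<close>

lemma q_mean_inverse_reflect:
  fixes r :: "'a::field"
  assumes r: "r \<noteq> 0"
  shows "q_mean (inverse r) (\<lambda>x. f ((1 - q_bracket r x) / r ^ x)) n
    = q_mean r (\<lambda>y. f ((q_bracket r (y + 2) - q_bracket r n) / r ^ n)) n"
proof -
  have "(\<Sum>x<n. f ((1 - q_bracket r x) / r ^ x) * inverse r ^ x)
      = (\<Sum>y<n. f ((1 - q_bracket r (n - Suc y)) / r ^ (n - Suc y)) * inverse r ^ (n - Suc y))"
    by (rule sum.nat_diff_reindex[symmetric])
  also have "\<dots> = (\<Sum>y<n. f ((q_bracket r (y + 2) - q_bracket r n) / r ^ n) * (r ^ y * (r / r ^ n)))"
  proof (rule sum.cong[OF refl])
    fix y assume "y \<in> {..<n}"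
    then obtain x where n: "n = Suc y + x"
      by (metis lessThan_iff less_iff_Suc_add add_Suc)
    \<comment> \<open>Both brackets are split at y + 1, and the common part [y + 1] cancels.\<close>
    have "q_bracket r (y + 2) - q_bracket r n = r ^ Suc y * (1 - q_bracket r x)"
      unfolding n q_bracket_add[of r "Suc y"] using q_bracket_Suc[of r "Suc y"]
      by (simp add: algebra_simps)
    \<comment> \<open>The factor r / r^n is independent of y; it cancels against the same factor in
      the normalisation to base 1/r.\<close>
    moreover have "inverse r ^ x = r ^ y * (r / r ^ n)"
      using r by (simp add: n power_add field_simps)
    ultimately show "f ((1 - q_bracket r (n - Suc y)) / r ^ (n - Suc y)) * inverse r ^ (n - Suc y)
        = f ((q_bracket r (y + 2) - q_bracket r n) / r ^ n) * (r ^ y * (r / r ^ n))"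
      using r by (simp add: n power_add)
  qed
  also have "\<dots> = (\<Sum>y<n. f ((q_bracket r (y + 2) - q_bracket r n) / r ^ n) * r ^ y) * (r / r ^ n)"
    by (simp only: sum_distrib_right mult.assoc)
  finally have "(\<Sum>x<n. f ((1 - q_bracket r x) / r ^ x) * inverse r ^ x)
      = (\<Sum>y<n. f ((q_bracket r (y + 2) - q_bracket r n) / r ^ n) * r ^ y) * (r / r ^ n)" .
  moreover have "q_bracket (inverse r) n = q_bracket r n * (r / r ^ n)"
    using q_bracket_inverse[OF r, of n] r by (simp add: field_simps)
  ultimately show ?thesis
    using r by (simp add: q_mean_def)
qed

text \<open>\<open>q_mean_shift\<close> is applied twice. The case split comes from the boundary
  term ([n]^k r^n - [0]^k) / [n]: it is r - 1 for k = 0, and tends to 1 for k = 1 and to 0 for k >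
  1.\<close>

lemma q_mean_moment_shift_tendsto:
  fixes r :: "'a::nonarch_field"
  assumes r: "r \<noteq> 0"
    and nz: "\<And>m. m > 0 \<Longrightarrow> q_bracket r m \<noteq> 0"
    and a: "\<And>N. a N > 0" "(\<lambda>N. q_bracket r (a N)) \<longlonglongrightarrow> 0"
  shows "(\<lambda>N. q_mean r (\<lambda>y. q_bracket r (y + 2) ^ k) (a N)) \<longlonglongrightarrow> (inverse r)\<^sup>2 *
    (carlitz_bernoulli r k + (if k = 0 then r - 1 else 0 ^ (k - 1)) + r * (r * of_nat k - (1 - r)))"
proof -
  define t where "t N = q_bracket r (a N)" for N
  have t: "t \<longlonglongrightarrow> 0" and t_nz: "t N \<noteq> 0" for N
    unfolding t_def using a nz by simp_all
  have pow: "r ^ a N = 1 - (1 - r) * t N" for N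
    unfolding t_def by (rule power_eq_q_bracket)
  define A where "A N = q_mean r (\<lambda>x. q_bracket r x ^ k) (a N)" for N
  \<comment> \<open>\<open>E\<close> and \<open>D\<close> are the boundary terms of the shifts from
    0 and from 1, with the division by [n] already carried out. In \<open>D\<close> the bracket to
    base 1 + r t stands for the quotient ((1 + r t)^k - 1) / (r t), whose limit is k.\<close>
  define E where "E N = (if k = 0 then r - 1 else t N ^ (k - 1) * (1 - (1 - r) * t N))" for N
  define D where "D N = r * q_bracket (1 + r * t N) k * (1 - (1 - r) * t N) - (1 - r)" for N
  have E: "(q_bracket r (a N) ^ k * r ^ a N - q_bracket r 0 ^ k) / q_bracket r (a N) = E N" for N
    unfolding E_def pow t_def[symmetric] using t_nz[of N] by (cases k) auto
  have D: "(q_bracket r (Suc (a N)) ^ k * r ^ a N - q_bracket r (Suc 0) ^ k) / q_bracket r (a N) = D N" for N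
  proof -
    have "q_bracket r (Suc (a N)) ^ k = 1 + r * t N * q_bracket (1 + r * t N) k"
      using power_eq_q_bracket[of "1 + r * t N" k] by (simp add: q_bracket_Suc' t_def)
    then show ?thesis
      unfolding D_def pow t_def[symmetric] using t_nz[of N]
      by (simp add: q_bracket_Suc' field_simps)
  qed
  have eq: "q_mean r (\<lambda>y. q_bracket r (y + 2) ^ k) (a N) = (inverse r)\<^sup>2 * (A N + E N + r * D N)" for N
  proof -
    have "r * (r * q_mean r (\<lambda>y. q_bracket r (Suc (Suc y)) ^ k) (a N)) = A N + E N + r * D N"
      using q_mean_shift[of r "\<lambda>x. q_bracket r (Suc x) ^ k" "a N"]
        q_mean_shift[of r "\<lambda>x. q_bracket r x ^ k" "a N"] D[of N] E[of N]
      by (simp add: A_def algebra_simps)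
    then show ?thesis
      using r by (simp add: field_simps power2_eq_square)
  qed
  have "(\<lambda>N. q_bracket (1 + r * t N) k) \<longlonglongrightarrow> q_bracket (1 + r * 0) k"
    unfolding q_bracket_def by (intro tendsto_intros t)
  then have D_lim: "D \<longlonglongrightarrow> r * of_nat k * (1 - (1 - r) * 0) - (1 - r)"
    unfolding D_def by (intro tendsto_intros t) simp
  have E_lim: "E \<longlonglongrightarrow> (if k = 0 then r - 1 else 0 ^ (k - 1) * (1 - (1 - r) * 0))"
    unfolding E_def by (cases "k = 0") (simp, simp only: if_False, intro tendsto_intros t)
  have A_lim: "A \<longlonglongrightarrow> carlitz_bernoulli r k"
    unfolding A_def by (rule q_mean_moment_tendsto[OF nz a])
  have "(\<lambda>N. (inverse r)\<^sup>2 * (A N + E N + r * D N)) \<longlonglongrightarrow> (inverse r)\<^sup>2 *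
      (carlitz_bernoulli r k + (if k = 0 then r - 1 else 0 ^ (k - 1) * (1 - (1 - r) * 0))
        + r * (r * of_nat k * (1 - (1 - r) * 0) - (1 - r)))"
    by (intro tendsto_mult tendsto_add tendsto_const A_lim E_lim D_lim)
  then show ?thesis
    unfolding eq by (simp only: mult_zero_right diff_zero mult_1_right)
qed

text \<open>After reflection, ([y + 2] - [n])^k is expanded; as [n] -> 0, only the term j = k
  survives. For k \<ge> 2 the boundary term at 0 vanishes in the limit, whereas k = 1 would add
  q^2.\<close>

lemma q_mean_reflected_moment_tendsto:
  fixes q :: "'a::nonarch_field"
  assumes q: "q \<noteq> 0"
    and nz: "\<And>m. m > 0 \<Longrightarrow> q_bracket (inverse q) m \<noteq> 0"
    and a: "\<And>N. a N > 0" "(\<lambda>N. q_bracket (inverse q) (a N)) \<longlonglongrightarrow> 0" "(\<lambda>N. q ^ a N) \<longlonglongrightarrow> 1"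
    and k: "k \<ge> 2"
  shows "(\<lambda>N. q_mean q (\<lambda>x. ((1 - q_bracket (inverse q) x) / inverse q ^ x) ^ k) (a N))
    \<longlonglongrightarrow> q\<^sup>2 * carlitz_bernoulli (inverse q) k + of_nat (k + 1) - q"
proof -
  define r where "r = inverse q"
  have r: "r \<noteq> 0" "inverse r = q"
    using q by (simp_all add: r_def)
  note nz = nz[folded r_def] and a = a[folded r_def]
  define C where "C j N = q_mean r (\<lambda>y. q_bracket r (y + 2) ^ j) (a N)" for j N
  define L where "L j = (inverse r)\<^sup>2 * (carlitz_bernoulli r j
    + (if j = 0 then r - 1 else 0 ^ (j - 1)) + r * (r * of_nat j - (1 - r)))" for j
  have C: "C j \<longlonglongrightarrow> L j" for j
    unfolding C_def L_def by (rule q_mean_moment_shift_tendsto[OF r(1) nz a(1,2)])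
  have eq: "q_mean q (\<lambda>x. ((1 - q_bracket r x) / r ^ x) ^ k) (a N)
      = (q ^ a N) ^ k * (\<Sum>j\<le>k. of_nat (k choose j) * (- q_bracket r (a N)) ^ (k - j) * C j N)" for N
  proof -
    have "((q_bracket r (y + 2) - q_bracket r (a N)) / r ^ a N) ^ k = (q ^ a N) ^ k *
        (\<Sum>j\<le>k. of_nat (k choose j) * (- q_bracket r (a N)) ^ (k - j) * q_bracket r (y + 2) ^ j)" for y
    proof -
      have "(q_bracket r (y + 2) - q_bracket r (a N)) / r ^ a N
          = q ^ a N * (q_bracket r (y + 2) + - q_bracket r (a N))"
        by (simp add: r_def power_inverse divide_inverse mult.commute)
      then have "((q_bracket r (y + 2) - q_bracket r (a N)) / r ^ a N) ^ k
          = (q ^ a N) ^ k * (q_bracket r (y + 2) + - q_bracket r (a N)) ^ k"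
        by (simp only: power_mult_distrib)
      then show ?thesis
        unfolding binomial_ring by (simp only: mult_ac)
    qed
    then show ?thesis
      using q_mean_inverse_reflect[OF r(1), of "\<lambda>z. z ^ k" "a N"]
      by (simp add: r(2) q_mean_cmult q_mean_sum C_def)
  qed
  have "(\<lambda>N. (q ^ a N) ^ k * (\<Sum>j\<le>k. of_nat (k choose j) * (- q_bracket r (a N)) ^ (k - j) * C j N))
      \<longlonglongrightarrow> 1 ^ k * (\<Sum>j\<le>k. of_nat (k choose j) * (- 0) ^ (k - j) * L j)"
    by (intro tendsto_intros a C)
  also have "(\<Sum>j\<le>k. of_nat (k choose j) * (- 0) ^ (k - j) * L j) = (\<Sum>j\<in>{k}. L j)"
    by (intro sum.mono_neutral_cong_right) auto
  also have "1 ^ k * (\<Sum>j\<in>{k}. L j) = q\<^sup>2 * carlitz_bernoulli r k + of_nat (k + 1) - q"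
    using k q by (simp add: L_def r_def field_simps power2_eq_square)
  finally show ?thesis
    by (simp add: eq flip: r_def)
qed

section \<open>The \<open>p\<close>-adic side\<close>

lemma absv_prat_of_nat:
  assumes "n > 0"
  shows "absv (of_nat n :: 'p::prime_card prat) = inverse (real CARD('p)) ^ multiplicity (int CARD('p)) (int n)"
proof -
  have "rat_padic_absv CARD('p) (of_int (int n) / of_int 1)
      = real CARD('p) powi (- int (multiplicity (int CARD('p)) (int n)))"
    using assms by (subst rat_padic_absv_frac[OF prime_card]) auto
  then show ?thesis
    by (simp add: absv_prat.rep_eq Rep_prat_of_nat power_int_minus power_inverse)
qed

lemma absv_padic_of_nat: "absv (of_nat n :: 'p::prime_card padic) = absv (of_nat n :: 'p prat)"
  by (metis absv_to_completion to_completion_of_nat)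

lemma absv_Cp_of_nat: "absv (of_nat n :: 'p::prime_card Cp) = absv (of_nat n :: 'p prat)"
  by (metis absv_to_completion absv_to_ac to_completion_of_nat to_ac_of_nat)

lemma of_nat_Cp_nonzero:
  assumes "n > 0"
  shows "of_nat n \<noteq> (0 :: 'p::prime_card Cp)"
proof -
  have "absv (of_nat n :: 'p Cp) > 0"
    unfolding absv_Cp_of_nat absv_prat_of_nat[OF assms] by simp
  then show ?thesis
    by simp
qed

lemma CARD_gt_1: "CARD('p::prime_card) > 1"
  using prime_card[where 'a = 'p] by (rule prime_gt_1_nat)

lemma absv_Cp_card_less_1: "absv (of_nat CARD('p) :: 'p::prime_card Cp) < 1"
  using CARD_gt_1[where 'p = 'p] by (simp add: absv_Cp_card)

text \<open>Converts p-adic closeness of exponents into a congruence modulo p^N, which is what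
  controls powers of q.\<close>

lemma absv_padic_of_nat_less_imp_dvd:
  assumes "absv (of_nat n :: 'p::prime_card padic) < inverse (real CARD('p)) ^ N"
  shows "CARD('p) ^ N dvd n"
proof (cases "n = 0")
  case False
  with assms have "inverse (real CARD('p)) ^ multiplicity (int CARD('p)) (int n) < inverse (real CARD('p)) ^ N"
    by (simp add: absv_padic_of_nat absv_prat_of_nat)
  moreover have "0 < inverse (real CARD('p))" "inverse (real CARD('p)) < 1"
    using CARD_gt_1[where 'p = 'p] by (auto simp: field_simps)
  ultimately have "N \<le> multiplicity (int CARD('p)) (int n)"
    by (metis linorder_not_le order.strict_implies_order order_less_irrefl order_less_trans power_strict_decreasing)
  then have "int CARD('p) ^ N dvd int n"
    by (rule multiplicity_dvd')
  then show ?thesis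
    by (metis of_nat_dvd_iff of_nat_power)
qed simp

lemma Rep_padic_int_of_nat [simp]: "Rep_padic_int (of_nat n :: 'p::prime_card padic_int) = of_nat n"
  by (induction n) (simp_all add: zero_padic_int.rep_eq one_padic_int.rep_eq plus_padic_int.rep_eq)

text \<open>
  An integer \<open>y\<close> is presented as a difference \<open>a - b\<close> of natural numbers, so that negative exponents,
  which occur in \<open>[1 - x]\<close>, are covered.
\<close>

lemma padic_power_diff:
  fixes q :: "'p::prime_card Cp"
  assumes q: "absv (1 - q) < 1" and y: "y + of_nat b = of_nat a"
  shows "padic_power q y = q ^ a / q ^ b"
proof -
  define F where "F = filtercomap of_nat (nhds (Rep_padic_int y))"
  have q1: "absv q = 1"
    by (rule absv_eq_1_of_near_1[OF q])
  then have q0: "q \<noteq> 0"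
    by auto
  have Rep: "Rep_padic_int y = of_nat a - of_nat b"
    using arg_cong[OF y, of Rep_padic_int] by (simp add: plus_padic_int.rep_eq eq_diff_eq)
  have p: "0 < inverse (real CARD('p))" "inverse (real CARD('p)) < 1"
    using CARD_gt_1[where 'p = 'p] by (auto simp: field_simps)
  \<comment> \<open>Since y = a - b, closeness of m to y is closeness of m + b to a, a statement
    about natural numbers only.\<close>
  have ev: "eventually P F \<longleftrightarrow> (\<exists>e>0. \<forall>m. absv (of_nat (m + b) - of_nat a :: 'p padic) < e \<longrightarrow> P m)" for P
  proof -
    have "dist (of_nat m) (Rep_padic_int y) = absv (of_nat (m + b) - of_nat a :: 'p padic)" for m
      by (simp add: dist_absv Rep algebra_simps)
    then have "(\<exists>e>0. \<forall>m. absv (of_nat (m + b) - of_nat a :: 'p padic) < e \<longrightarrow> P m) \<longleftrightarrow>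
        (\<exists>e>0. \<forall>m. dist (of_nat m) (Rep_padic_int y) < e \<longrightarrow> P m)"
      by simp
    also have "\<dots> \<longleftrightarrow> eventually P F"
      unfolding F_def eventually_filtercomap eventually_nhds_metric
    proof
      assume "\<exists>e>0. \<forall>m. dist (of_nat m) (Rep_padic_int y) < e \<longrightarrow> P m"
      then obtain e where "e > 0" "\<forall>m. dist (of_nat m) (Rep_padic_int y) < e \<longrightarrow> P m"
        by blast
      then show "\<exists>Q. (\<exists>d>0. \<forall>x. dist x (Rep_padic_int y) < d \<longrightarrow> Q x) \<and> (\<forall>m. Q (of_nat m) \<longrightarrow> P m)"
        by (intro exI[of _ "\<lambda>x. dist x (Rep_padic_int y) < e"]) blast
    qed auto
    finally show ?thesis ..
  qed
  have "F \<noteq> bot"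
  proof
    assume "F = bot"
    then obtain e where e: "e > 0" "\<And>m. \<not> absv (of_nat (m + b) - of_nat a :: 'p padic) < e"
      using ev[of "\<lambda>_. False"] by auto
    obtain N where N: "inverse (real CARD('p)) ^ N < e"
      using real_arch_pow_inv[OF e(1) p(2)] by blast
    obtain l where l: "CARD('p) ^ N = Suc l"
      using gr0_implies_Suc[of "CARD('p) ^ N"] by auto
    \<comment> \<open>This natural number equals a + b (p^N - 1), hence is congruent to a - b modulo
      p^N. It shows that the filter is proper, so that the limit is unique.\<close>
    define m where "m = a + b * l"
    have "m + b = a + b * CARD('p) ^ N"
      unfolding m_def l by simp
    then have "of_nat (m + b) - of_nat a = (of_nat b * of_nat CARD('p) ^ N :: 'p padic)"
      by simp
    then have "absv (of_nat (m + b) - of_nat a :: 'p padic)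
        = absv (of_nat b :: 'p padic) * inverse (real CARD('p)) ^ N"
      by (simp only: absv_mult absv_power absv_padic_of_nat absv_prat_card inverse_eq_divide)
    also have "\<dots> \<le> inverse (real CARD('p)) ^ N"
    proof -
      have "absv (of_nat b :: 'p padic) = absv (\<Sum>i<b. 1 :: 'p padic)"
        by simp
      also have "\<dots> \<le> 1"
        by (rule absv_sum_le) auto
      finally show ?thesis
        using p(1) by (simp add: mult_left_le_one_le)
    qed
    finally show False
      using e(2)[of m] N by linarith
  qed
  moreover have "((\<lambda>m. q ^ m) \<longlongrightarrow> q ^ a / q ^ b) F"
  proof (rule tendstoI)
    fix e :: real assume e: "e > 0"
    have "(\<lambda>N. q ^ CARD('p) ^ N) \<longlonglongrightarrow> 1"
      by (rule power_prime_power_tendsto_1[OF q absv_Cp_card_less_1])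
    from metric_LIMSEQ_D[OF this e] obtain N where N: "dist (q ^ CARD('p) ^ N) 1 < e"
      by blast
    \<comment> \<open>For exponents congruent modulo p^N, the difference of the powers is a unit
      times 1 - (q^(p^N))^l, hence no larger than 1 - q^(p^N).\<close>
    have mono: "absv (q ^ i - q ^ j) < e" if "i \<le> j" "CARD('p) ^ N dvd j - i" for i j
    proof -
      obtain l where "j = i + CARD('p) ^ N * l"
        using \<open>i \<le> j\<close> \<open>CARD('p) ^ N dvd j - i\<close> by (metis dvdE le_add_diff_inverse)
      then have "absv (q ^ i - q ^ j) = absv (q ^ i * (1 - (q ^ CARD('p) ^ N) ^ l))"
        by (simp only: power_add power_mult right_diff_distrib mult_1_right)
      also have "\<dots> = absv (1 - (q ^ CARD('p) ^ N) ^ l)"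
        by (simp add: absv_mult absv_power q1)
      also have "\<dots> \<le> absv (1 - q ^ CARD('p) ^ N)"
        by (rule absv_power_minus_1_le) (simp add: absv_power q1)
      also have "\<dots> < e"
        using N by (simp add: dist_absv absv_minus_commute)
      finally show ?thesis .
    qed
    have "dist (q ^ m) (q ^ a / q ^ b) < e"
      if m: "absv (of_nat (m + b) - of_nat a :: 'p padic) < inverse (real CARD('p)) ^ N" for m
    proof -
      have "dist (q ^ m) (q ^ a / q ^ b) = absv ((q ^ (m + b) - q ^ a) / q ^ b)"
        using q0 by (simp add: dist_absv power_add diff_divide_distrib)
      also have "\<dots> = absv (q ^ (m + b) - q ^ a)"
        by (simp add: absv_divide absv_power q1)
      also have "\<dots> < e"
      proof (cases "m + b \<le> a")
        case True
        then have "absv (of_nat (a - (m + b)) :: 'p padic) < inverse (real CARD('p)) ^ N"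
          using m by (simp add: of_nat_diff absv_minus_commute)
        with True show ?thesis
          by (intro mono absv_padic_of_nat_less_imp_dvd)
      next
        case False
        then have "absv (of_nat (m + b - a) :: 'p padic) < inverse (real CARD('p)) ^ N"
          using m by (simp add: of_nat_diff)
        with False show ?thesis
          by (subst absv_minus_commute) (intro mono absv_padic_of_nat_less_imp_dvd; simp)
      qed
      finally show ?thesis .
    qed
    then show "\<forall>\<^sub>F m in F. dist (q ^ m) (q ^ a / q ^ b) < e"
      unfolding ev using p(1) by (intro exI[of _ "inverse (real CARD('p)) ^ N"]) auto
  qed
  ultimately show ?thesis
    unfolding padic_power_def F_def[symmetric] by (rule tendsto_Lim)
qed

text \<open>The bracket form is uniform in q, including q = 1. The choices b = 0 and a = 1 give [n]
  and [1 - x].\<close>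

lemma q_number_diff:
  fixes q :: "'p::prime_card Cp"
  assumes q: "absv (1 - q) < 1" and y: "y + of_nat b = of_nat a"
  shows "q_number q y = (q_bracket q a - q_bracket q b) / q ^ b"
proof (cases "q = 1")
  case True
  have "Rep_padic_int y + of_nat b = of_nat a"
    using arg_cong[OF y, of Rep_padic_int] by (simp add: plus_padic_int.rep_eq)
  from arg_cong[OF this, of "\<lambda>z. to_completion (to_ac z)"]
  have "of_padic_int y + of_nat b = of_nat a"
    by (simp add: of_padic_int_def)
  then show ?thesis
    by (simp add: q_number_def True eq_diff_eq)
next
  case False
  have "q \<noteq> 0"
    using absv_eq_1_of_near_1[OF q] by auto
  then have "1 - q ^ a / q ^ b = (q ^ b - q ^ a) / q ^ b"
    by (simp add: diff_divide_distrib)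
  moreover have "q_bracket q a - q_bracket q b = (q ^ b - q ^ a) / (1 - q)"
    using False by (simp add: q_bracket_eq_divide flip: diff_divide_distrib)
  ultimately show ?thesis
    using False by (simp add: q_number_def padic_power_diff[OF q y])
qed

lemma q_number_of_nat:
  fixes q :: "'p::prime_card Cp"
  assumes "absv (1 - q) < 1"
  shows "q_number q (of_nat n) = q_bracket q n"
  using q_number_diff[OF assms, of "of_nat n" 0 n] by simp

lemma q_number_one_minus_of_nat:
  fixes q :: "'p::prime_card Cp"
  assumes "absv (1 - q) < 1"
  shows "q_number q (1 - of_nat x) = (1 - q_bracket q x) / q ^ x"
  using q_number_diff[OF assms, of "1 - of_nat x" x 1] by (simp add: q_bracket_def)

lemma q_integral_eqI:
  fixes q :: "'p::prime_card Cp"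
  assumes "absv (1 - q) < 1" "(\<lambda>N. q_mean q (\<lambda>x. f (of_nat x)) (CARD('p) ^ N)) \<longlonglongrightarrow> L"
  shows "q_integral q f = L"
  using assms(2) unfolding q_integral_def q_mean_def q_number_of_nat[OF assms(1)]
  by (intro limI) simp

text \<open>Excluding roots of unity other than 1 keeps the denominators [m] of the means and of the
  solved recurrence nonzero, for q as well as for 1/q.\<close>

theorem theorem4:
  fixes q :: "'p::prime_card Cp" and n k :: nat
  assumes "absv (1 - q) < 1"
    and "\<forall>m>0. q ^ m = 1 \<longrightarrow> q = 1"
  shows "let J = q_integral q (\<lambda>x2. q_integral q (\<lambda>x1. q_bernstein q k n x1 x2)) in
    (n > k + 1 \<longrightarrow> J = of_nat (n choose k) * carlitz_bernoulli q k *
        (q\<^sup>2 * carlitz_bernoulli (inverse q) (n - k) + of_nat (n - k + 1) - q)) \<and>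
    (n < k \<longrightarrow> J = 0) \<and>
    (n = k \<longrightarrow> J = carlitz_bernoulli q k) \<and>
    (n = k \<and> k = 0 \<longrightarrow> J = 1)"
proof -
  define J where "J = q_integral q (\<lambda>x2. q_integral q (\<lambda>x1. q_bernstein q k n x1 x2))"
  define r where "r = inverse q"
  have q1: "absv q = 1"
    by (rule absv_eq_1_of_near_1[OF assms(1)])
  then have q0: "q \<noteq> 0"
    by auto
  then have "1 - r = (q - 1) / q"
    by (simp add: r_def field_simps)
  then have r: "absv (1 - r) < 1"
    using assms(1) q1 by (simp add: absv_divide absv_minus_commute)
  have r_unity: "\<forall>m>0. r ^ m = 1 \<longrightarrow> r = 1"
    using assms(2) by (simp add: r_def power_inverse)
  have nz: "q_bracket q m \<noteq> 0" "q_bracket r m \<noteq> 0" if "m > 0" for m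
    using q_bracket_nonzero[OF assms(2)] q_bracket_nonzero[OF r_unity] of_nat_Cp_nonzero that by blast+
  have pos: "CARD('p) ^ N > 0" for N
    by simp
  note lims = q_bracket_prime_power_tendsto_0[OF assms(1) absv_Cp_card_less_1]
    q_bracket_prime_power_tendsto_0[OF r absv_Cp_card_less_1]
    power_prime_power_tendsto_1[OF assms(1) absv_Cp_card_less_1]
  have moment: "(\<lambda>N. q_mean q (\<lambda>x. q_bracket q x ^ k) (CARD('p) ^ N)) \<longlonglongrightarrow> carlitz_bernoulli q k"
    using nz(1) pos lims(1) by (rule q_mean_moment_tendsto)
  \<comment> \<open>The integrand is a product, so for fixed \<open>x2\<close> the inner integral is
    a constant times the k-th moment.\<close>
  have inner: "q_integral q (\<lambda>x1. q_bernstein q k n x1 x2)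
      = of_nat (n choose k) * carlitz_bernoulli q k * q_number r (1 - x2) ^ (n - k)" if "n \<ge> k" for x2
  proof (rule q_integral_eqI[OF assms(1)])
    define c where "c = of_nat (n choose k) * q_number r (1 - x2) ^ (n - k)"
    have "q_bernstein q k n (of_nat x) x2 = c * q_bracket q x ^ k" for x
      using that by (simp add: q_bernstein_def q_number_of_nat[OF assms(1)] c_def flip: r_def)
    moreover have "(\<lambda>N. c * q_mean q (\<lambda>x. q_bracket q x ^ k) (CARD('p) ^ N)) \<longlonglongrightarrow> c * carlitz_bernoulli q k"
      by (intro tendsto_intros moment)
    moreover have "c * carlitz_bernoulli q k
        = of_nat (n choose k) * carlitz_bernoulli q k * q_number r (1 - x2) ^ (n - k)"
      by (simp add: c_def)
    ultimately show "(\<lambda>N. q_mean q (\<lambda>x. q_bernstein q k n (of_nat x) x2) (CARD('p) ^ N))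
        \<longlonglongrightarrow> of_nat (n choose k) * carlitz_bernoulli q k * q_number r (1 - x2) ^ (n - k)"
      by (simp only: q_mean_cmult)
  qed
  \<comment> \<open>Serves n < k, where the integrand is 0, and n = k, where the factor in
    \<open>x2\<close> has exponent 0.\<close>
  have const: "q_integral q (\<lambda>x. c) = c" for c
    by (rule q_integral_eqI[OF assms(1)]) (simp add: q_mean_const nz(1))
  have "J = of_nat (n choose k) * carlitz_bernoulli q k *
      (q\<^sup>2 * carlitz_bernoulli r (n - k) + of_nat (n - k + 1) - q)" if "n > k + 1"
    unfolding J_def
  proof (rule q_integral_eqI[OF assms(1)])
    have "n \<ge> k" and nk: "n - k \<ge> 2"
      using that by auto
    have "(\<lambda>N. q_mean q (\<lambda>x. ((1 - q_bracket r x) / r ^ x) ^ (n - k)) (CARD('p) ^ N))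
        \<longlonglongrightarrow> q\<^sup>2 * carlitz_bernoulli r (n - k) + of_nat (n - k + 1) - q"
      unfolding r_def
      by (rule q_mean_reflected_moment_tendsto[OF q0 nz(2)[unfolded r_def] pos lims(2)[unfolded r_def] lims(3) nk])
    then show "(\<lambda>N. q_mean q (\<lambda>x. q_integral q (\<lambda>x1. q_bernstein q k n x1 (of_nat x))) (CARD('p) ^ N))
        \<longlonglongrightarrow> of_nat (n choose k) * carlitz_bernoulli q k *
          (q\<^sup>2 * carlitz_bernoulli r (n - k) + of_nat (n - k + 1) - q)"
      unfolding inner[OF \<open>n \<ge> k\<close>] q_number_one_minus_of_nat[OF r] q_mean_cmult
      by (rule tendsto_mult[OF tendsto_const])
  qed
  moreover have "J = 0" if "n < k"
    using that const[of 0] by (simp add: J_def q_bernstein_def)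
  moreover have J: "J = carlitz_bernoulli q k" if "n = k"
    using that inner const by (simp add: J_def)
  moreover have "J = 1" if "n = k \<and> k = 0"
  proof -
    \<comment> \<open>The zeroth moment is the mean of the constant 1, which identifies the Carlitz
      number of index 0.\<close>
    have "(\<lambda>N. q_mean q (\<lambda>x. q_bracket q x ^ 0) (CARD('p) ^ N)) \<longlonglongrightarrow> 1"
      by (simp add: q_mean_const nz(1))
    with that moment have "carlitz_bernoulli q k = 1"
      by (intro LIMSEQ_unique[OF moment]) simp
    with J that show ?thesis
      by simp
  qed
  ultimately show ?thesis
    unfolding Let_def J_def r_def by blast
qed

end
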